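(* Assume that $(\pi,\tau)$ is of dual Roth type. Then, for every $\eta\in(0,1)$, there is a constant $C(\eta)$ such that for every function $\psi$ on $L^{(0)}$ which has mean value $0$ and is Hölder continuous with exponent $\eta$, the dual Birkhoff sums $S^\sharp(0,n)\psi$, $n\le0$, satisfy $$\|S^\sharp(0,n)\psi\|_{C^0}\le C(\eta)\,\|\psi\|_{C^\eta}\,\|B(n,0)\|^{1-\frac1{20}\theta\eta},$$ where $\theta$ is the exponent appearing in condition (b) of the definition of dual Roth type.
   Context: Let $\mathcal A$ be an alphabet with $d\ge2$ letters and $\pi=(\pi_t,\pi_b)$ an irreducible pair of bijections $\mathcal A\to\{1,\dots,d\}$ (irreducible: $\pi_t^{-1}(\{1,\dots,k\})\ne\pi_b^{-1}(\{1,\dots,k\})$ for $1\le k<d$). $\Omega_\pi$ is the antisymmetric matrix with $\Omega_{\alpha\beta}=1$ if $\pi_t(\alpha)<\pi_t(\beta),\pi_b(\alpha)>\pi_b(\beta)$, $-1$ if $\pi_t(\alpha)>\pi_t(\beta),\pi_b(\alpha)<\pi_b(\beta)$, $0$ otherwise. Let $\tau\in\Theta_\pi$, i.e. $\sum_{\pi_t(\alpha)<k}\tau_\alpha>0$ and $\sum_{\pi_b(\alpha)<k}\tau_\alpha<0$ for $1<k\le d$, and let $\lambda\in(0,\infty)^{\mathcal A}$ (any choice; the objects below do not depend on it). Backward Rauzy--Veech algorithm. Starting from $(\pi^{(0)},\lambda^{(0)},\tau^{(0)})=(\pi,\lambda,\tau)$, for $n\le0$: if $\sum_\alpha\tau_\alpha^{(n)}<0$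 (top type), let $\pi_t^{(n)}(\alpha_w)=d$, $\pi_b^{(n)}(\alpha_\ell)=\pi_b^{(n)}(\alpha_w)+1$; $\pi^{(n-1)}$ is obtained by moving $\alpha_\ell$ to the last place of the bottom row. If $\sum_\alpha\tau_\alpha^{(n)}>0$ (bottom type), do the same exchanging the roles of $t$ and $b$. In both cases the $\alpha_w$-entries of $\lambda^{(n-1)},\tau^{(n-1)}$ are those of index $n$ plus the $\alpha_\ell$-entries, other entries being unchanged. The arrow $\gamma_n:\pi^{(n-1)}\to\pi^{(n)}$ has winner $\alpha_w$, loser $\alpha_\ell$ and matrix $B_{\gamma_n}=\mathrm{Id}+E_{\alpha_\ell\alpha_w}$; $B(m,n)=B_{\gamma_n}\cdots B_{\gamma_{m+1}}$ for $m\le n\le0$. The backward rotation number is the path $\cdots\star\gamma_{-1}\star\gamma_0$, depending only on $(\pi,\tau)$. A finite path is complete if every letter is the winner of at least one of its arrows; an infinite path is $\infty$-complete if it is a concatenation of infinitely many complete paths. Let $T^{(n)}$ be the interval exchange map with data $(\pi^{(n)},\lambda^{(n)})$, on $I^{(n)}=(0,\sum_\alpha\lambda_\alpha^{(n)})$, translating intervals $I_\alpha^{(n)}$ of length $\lambda^{(n)}_\alpha$, ordered by $\pi_t^{(n)}$, onto intervals of the same length ordered by $\pi_b^{(n)}$; for $n'\le n$, $T^{(n)}$ is the first return map of $T^{(n')}$ to $I^{(n)}$. Norm: $\|B\|=\sum_{\alpha,\beta}|B_{\alpha\beta}|$. Dual special Birkhoff sums. Put $q^{(n)}=-\Omega_{\pi^{(n)}}\tau^{(n)}$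 (positive entries), $L_\alpha^{(n)}=(0,q_\alpha^{(n)})$ and $L^{(n)}=\bigsqcup_\alpha L_\alpha^{(n)}$. For $n'\le n\le0$ and $0\le j<B_\alpha(n',n):=\sum_\beta B(n',n)_{\alpha\beta}$, let $\beta(\alpha,j)$ be the letter with $(T^{(n')})^j(I_\alpha^{(n)})\subset I_{\beta(\alpha,j)}^{(n')}$ and $Sq_\alpha(j)=\sum_{0\le i<j}q^{(n')}_{\beta(\alpha,i)}$; then $L_\alpha^{(n)}$ is, mod $0$, the disjoint union of the translates $L^{(n')}_{\beta(\alpha,j)}+Sq_\alpha(j)$. For $\psi=(\psi_\alpha)$ a function on $L^{(n)}$, $S^\sharp(n,n')\psi$ is the function on $L^{(n')}$ given for $x\in L_\beta^{(n')}$ by $$S^\sharp(n,n')\psi(x)=\sum_{\alpha\in\mathcal A}\ \sum_{\substack{0\le j<B_\alpha(n',n)\\ \beta(\alpha,j)=\beta}}\psi_\alpha\big(x+Sq_\alpha(j)\big).$$ A function on $L^{(0)}$ is Hölder of exponent $\eta$ if it is so on each $L^{(0)}_\alpha$; mean value $0$ means $\int_{L^{(0)}}\psi=0$. Dual Roth type. Put $\hat n_0=0$ and, for $k\le0$, let $\hat n_{k-1}$ be the largest $n<\hat n_k$ such that $\gamma_{n+1}\star\cdots\star\gamma_{\hat n_k}$ is complete. $(\pi,\tau)$ is of (weak) dual Roth type if its backward rotation number is defined and $\infty$-complete and: (a) for every $\varepsilon>0$ there is $C_0>0$ with $\|B(\hat n_{k-1},\hat n_k)\|\le C_0\|B(\hat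 n_k,0)\|^\varepsilon$ for all $k\le0$; (b) there are $\theta>0,C_1>0$ with $\|{}^tB_0(n,0)\|\le C_1\|{}^tB(n,0)\|^{1-\theta}$ for all $n\le0$, where ${}^tB_0(n,0)$ is the restriction of ${}^tB(n,0)$ to the hyperplane $\{v\in\mathbb R^{\mathcal A}:\sum_\alpha q_\alpha^{(0)}v_\alpha=0\}$. *)

theory Defs
  imports "HOL-Analysis.Analysis"
begin

text \<open>
  The alphabet is a finite type \<open>'a\<close>, so \<open>d = CARD('a)\<close>. A pair \<open>(\<pi>\<^sub>t, \<pi>\<^sub>b)\<close> of bijections onto
  \<open>{1..d}\<close> is a pair of functions \<open>'a \<Rightarrow> nat\<close>. Times are integers \<open>n \<le> 0\<close>; the functions of
  time defined below carry no information for positive \<open>n\<close>.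
\<close>

type_synonym 'a rows = "('a \<Rightarrow> nat) \<times> ('a \<Rightarrow> nat)"

definition irreducible_rows :: "'a::finite rows \<Rightarrow> bool" where
  "irreducible_rows p \<longleftrightarrow>
     bij_betw (fst p) UNIV {1..CARD('a)} \<and> bij_betw (snd p) UNIV {1..CARD('a)} \<and>
     (\<forall>k. 1 \<le> k \<and> k < CARD('a) \<longrightarrow> fst p -` {1..k} \<noteq> snd p -` {1..k})"

definition Omega :: "'a::finite rows \<Rightarrow> real^'a^'a" where
  "Omega p = (\<chi> \<alpha> \<beta>.
     if fst p \<alpha> < fst p \<beta> \<and> snd p \<alpha> > snd p \<beta> then 1
     else if fst p \<alpha> > fst p \<beta> \<and> snd p \<alpha> < snd p \<beta> then - 1
     else 0)"

definition Theta :: "'a::finite rows \<Rightarrow> (real^'a) set" where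
  "Theta p = {\<tau>. \<forall>k. 1 < k \<and> k \<le> CARD('a) \<longrightarrow>
     (\<Sum>\<alpha> | fst p \<alpha> < k. \<tau> $ \<alpha>) > 0 \<and> (\<Sum>\<alpha> | snd p \<alpha> < k. \<tau> $ \<alpha>) < 0}"


subsection \<open>The backward Rauzy--Veech algorithm\<close>

text \<open>
  The algorithm stops when \<open>\<Sum>\<^sub>\<alpha> \<tau>\<^sub>\<alpha> = 0\<close>. The functions below are total and then take
  irrelevant values; this case is excluded by \<open>backward_defined\<close>.
\<close>

definition top_type :: "real^'a::finite \<Rightarrow> bool" where
  "top_type \<tau> \<longleftrightarrow> (\<Sum>\<alpha>\<in>UNIV. \<tau> $ \<alpha>) < 0"

definition winner :: "'a::finite rows \<Rightarrow> real^'a \<Rightarrow> 'a" where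
  "winner p \<tau> =
     (if top_type \<tau> then THE \<alpha>. fst p \<alpha> = CARD('a) else THE \<alpha>. snd p \<alpha> = CARD('a))"

definition loser :: "'a::finite rows \<Rightarrow> real^'a \<Rightarrow> 'a" where
  "loser p \<tau> =
     (if top_type \<tau> then THE \<alpha>. snd p \<alpha> = snd p (winner p \<tau>) + 1
      else THE \<alpha>. fst p \<alpha> = fst p (winner p \<tau>) + 1)"

definition move_last :: "'a::finite \<Rightarrow> ('a \<Rightarrow> nat) \<Rightarrow> 'a \<Rightarrow> nat" where
  "move_last \<alpha> r = (\<lambda>\<beta>. if \<beta> = \<alpha> then CARD('a) else if r \<beta> > r \<alpha> then r \<beta> - 1 else r \<beta>)"

definition prev_rows :: "'a::finite rows \<Rightarrow> real^'a \<Rightarrow> 'a rows" where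
  "prev_rows p \<tau> =
     (if top_type \<tau> then (fst p, move_last (loser p \<tau>) (snd p))
      else (move_last (loser p \<tau>) (fst p), snd p))"

text \<open>The common update rule of the length data \<open>\<lambda>\<close> and of the suspension data \<open>\<tau>\<close>.\<close>

definition prev_vec :: "'a::finite rows \<Rightarrow> real^'a \<Rightarrow> real^'a \<Rightarrow> real^'a" where
  "prev_vec p \<tau> v =
     (\<chi> \<alpha>. if \<alpha> = winner p \<tau> then v $ \<alpha> + v $ loser p \<tau> else v $ \<alpha>)"

definition rv_step :: "'a::finite rows \<times> (real^'a) \<Rightarrow> 'a rows \<times> (real^'a)" where
  "rv_step = (\<lambda>(p, \<tau>). (prev_rows p \<tau>, prev_vec p \<tau> \<tau>))"

definition rows_at :: "'a::finite rows \<Rightarrow> real^'a \<Rightarrow> int \<Rightarrow> 'a rows" where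
  "rows_at p \<tau> n = fst ((rv_step ^^ nat (- n)) (p, \<tau>))"

definition tau_at :: "'a::finite rows \<Rightarrow> real^'a \<Rightarrow> int \<Rightarrow> real^'a" where
  "tau_at p \<tau> n = snd ((rv_step ^^ nat (- n)) (p, \<tau>))"

text \<open>
  \<open>\<lambda>\<close> does not influence the course of the algorithm, so it is transported separately and
  everything that depends only on \<open>(\<pi>, \<tau>)\<close> is defined without reference to it.
\<close>

primrec lam_back :: "'a::finite rows \<Rightarrow> real^'a \<Rightarrow> real^'a \<Rightarrow> nat \<Rightarrow> real^'a" where
  "lam_back p \<tau> lam 0 = lam"
| "lam_back p \<tau> lam (Suc k) =
     prev_vec (rows_at p \<tau> (- int k)) (tau_at p \<tau> (- int k)) (lam_back p \<tau> lam k)"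

definition lam_at :: "'a::finite rows \<Rightarrow> real^'a \<Rightarrow> real^'a \<Rightarrow> int \<Rightarrow> real^'a" where
  "lam_at p \<tau> lam n = lam_back p \<tau> lam (nat (- n))"

definition arrow_winner :: "'a::finite rows \<Rightarrow> real^'a \<Rightarrow> int \<Rightarrow> 'a" where
  "arrow_winner p \<tau> n = winner (rows_at p \<tau> n) (tau_at p \<tau> n)"

definition arrow_loser :: "'a::finite rows \<Rightarrow> real^'a \<Rightarrow> int \<Rightarrow> 'a" where
  "arrow_loser p \<tau> n = loser (rows_at p \<tau> n) (tau_at p \<tau> n)"

definition arrow_matrix :: "'a::finite rows \<Rightarrow> real^'a \<Rightarrow> int \<Rightarrow> real^'a^'a" where
  "arrow_matrix p \<tau> n = mat 1 +
     (\<chi> \<alpha> \<beta>. if \<alpha> = arrow_loser p \<tau> n \<and> \<beta> = arrow_winner p \<tau> n then 1 else 0)"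

text \<open>\<open>B_back p \<tau> n k\<close> is \<open>B(n - k, n)\<close>, the product of the matrices of
  \<open>\<gamma>\<^sub>n, \<dots>, \<gamma>\<^bsub>n-k+1\<^esub>\<close> in this order.\<close>

primrec B_back :: "'a::finite rows \<Rightarrow> real^'a \<Rightarrow> int \<Rightarrow> nat \<Rightarrow> real^'a^'a" where
  "B_back p \<tau> n 0 = mat 1"
| "B_back p \<tau> n (Suc k) = B_back p \<tau> n k ** arrow_matrix p \<tau> (n - int k)"

definition Bmat :: "'a::finite rows \<Rightarrow> real^'a \<Rightarrow> int \<Rightarrow> int \<Rightarrow> real^'a^'a" where
  "Bmat p \<tau> m n = B_back p \<tau> n (nat (n - m))"

definition mat_norm :: "real^'a::finite^'a \<Rightarrow> real" where
  "mat_norm A = (\<Sum>\<alpha>\<in>UNIV. \<Sum>\<beta>\<in>UNIV. \<bar>A $ \<alpha> $ \<beta>\<bar>)"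


subsection \<open>Dual Roth type\<close>

definition backward_defined :: "'a::finite rows \<Rightarrow> real^'a \<Rightarrow> bool" where
  "backward_defined p \<tau> \<longleftrightarrow> (\<forall>n\<le>0. (\<Sum>\<alpha>\<in>UNIV. tau_at p \<tau> n $ \<alpha>) \<noteq> 0)"

text \<open>Completeness of the path \<open>\<gamma>\<^bsub>m+1\<^esub> \<star> \<dots> \<star> \<gamma>\<^sub>n\<close>.\<close>

definition complete_path :: "'a::finite rows \<Rightarrow> real^'a \<Rightarrow> int \<Rightarrow> int \<Rightarrow> bool" where
  "complete_path p \<tau> m n \<longleftrightarrow> (\<forall>\<alpha>. \<exists>i. m < i \<and> i \<le> n \<and> arrow_winner p \<tau> i = \<alpha>)"

definition infinitely_complete :: "'a::finite rows \<Rightarrow> real^'a \<Rightarrow> bool" where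
  "infinitely_complete p \<tau> \<longleftrightarrow>
     (\<exists>m :: nat \<Rightarrow> int. m 0 = 0 \<and>
        (\<forall>k. m (Suc k) < m k \<and> complete_path p \<tau> (m (Suc k)) (m k)))"

text \<open>The times form a decreasing sequence; \<open>n_hat p \<tau> k\<close> is the one with index \<open>-k\<close>.\<close>

primrec n_hat :: "'a::finite rows \<Rightarrow> real^'a \<Rightarrow> nat \<Rightarrow> int" where
  "n_hat p \<tau> 0 = 0"
| "n_hat p \<tau> (Suc k) = (GREATEST n. n < n_hat p \<tau> k \<and> complete_path p \<tau> n (n_hat p \<tau> k))"

definition q_at :: "'a::finite rows \<Rightarrow> real^'a \<Rightarrow> int \<Rightarrow> real^'a" where
  "q_at p \<tau> n = - (Omega (rows_at p \<tau> n) *v tau_at p \<tau> n)"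

text \<open>The norm of the restriction of \<open>A\<close> to the subspace \<open>H\<close>, with respect to Euclidean norms.\<close>

definition restricted_norm :: "real^'a::finite^'a \<Rightarrow> (real^'a) set \<Rightarrow> real" where
  "restricted_norm A H = (SUP v\<in>{v\<in>H. norm v \<le> 1}. norm (A *v v))"

definition dual_Roth_a :: "'a::finite rows \<Rightarrow> real^'a \<Rightarrow> bool" where
  "dual_Roth_a p \<tau> \<longleftrightarrow>
     (\<forall>\<epsilon>>0. \<exists>C0>0. \<forall>k.
        mat_norm (Bmat p \<tau> (n_hat p \<tau> (Suc k)) (n_hat p \<tau> k))
          \<le> C0 * mat_norm (Bmat p \<tau> (n_hat p \<tau> k) 0) powr \<epsilon>)"

definition dual_Roth_b :: "'a::finite rows \<Rightarrow> real^'a \<Rightarrow> real \<Rightarrow> bool" where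
  "dual_Roth_b p \<tau> \<theta> \<longleftrightarrow> \<theta> > 0 \<and>
     (\<exists>C1>0. \<forall>n\<le>0.
        restricted_norm (transpose (Bmat p \<tau> n 0)) {v. (\<Sum>\<alpha>\<in>UNIV. q_at p \<tau> 0 $ \<alpha> * v $ \<alpha>) = 0}
          \<le> C1 * mat_norm (transpose (Bmat p \<tau> n 0)) powr (1 - \<theta>))"

definition dual_Roth_type :: "'a::finite rows \<Rightarrow> real^'a \<Rightarrow> bool" where
  "dual_Roth_type p \<tau> \<longleftrightarrow>
     backward_defined p \<tau> \<and> infinitely_complete p \<tau> \<and>
     dual_Roth_a p \<tau> \<and> (\<exists>\<theta>. dual_Roth_b p \<tau> \<theta>)"


subsection \<open>Interval exchange maps\<close>

definition iet_left :: "('a::finite \<Rightarrow> nat) \<Rightarrow> real^'a \<Rightarrow> 'a \<Rightarrow> real" where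
  "iet_left r lam \<alpha> = (\<Sum>\<beta> | r \<beta> < r \<alpha>. lam $ \<beta>)"

definition iet_interval :: "'a::finite rows \<Rightarrow> real^'a \<Rightarrow> 'a \<Rightarrow> real set" where
  "iet_interval p lam \<alpha> = {iet_left (fst p) lam \<alpha> <..< iet_left (fst p) lam \<alpha> + lam $ \<alpha>}"

text \<open>The map is the identity off the open intervals, that is at the singularities and outside
  \<open>(0, \<Sum>\<^sub>\<alpha> \<lambda>\<^sub>\<alpha>)\<close>; these values are irrelevant.\<close>

definition iet :: "'a::finite rows \<Rightarrow> real^'a \<Rightarrow> real \<Rightarrow> real" where
  "iet p lam x =
     (if \<exists>\<alpha>. x \<in> iet_interval p lam \<alpha> then
        let \<alpha> = (THE \<alpha>. x \<in> iet_interval p lam \<alpha>)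
        in x - iet_left (fst p) lam \<alpha> + iet_left (snd p) lam \<alpha>
      else x)"


subsection \<open>Dual special Birkhoff sums\<close>

text \<open>A function on \<open>L\<^sup>(\<^sup>n\<^sup>) = \<Squnion>\<^sub>\<alpha> L\<^sub>\<alpha>\<^sup>(\<^sup>n\<^sup>)\<close> is a family \<open>\<psi> :: 'a \<Rightarrow> real \<Rightarrow> real\<close> whose values \<open>\<psi> \<alpha> x\<close>
  are only used for \<open>x\<close> in \<open>L p \<tau> n \<alpha>\<close>.\<close>

definition L :: "'a::finite rows \<Rightarrow> real^'a \<Rightarrow> int \<Rightarrow> 'a \<Rightarrow> real set" where
  "L p \<tau> n \<alpha> = {0 <..< q_at p \<tau> n $ \<alpha>}"

definition B_row :: "'a::finite rows \<Rightarrow> real^'a \<Rightarrow> int \<Rightarrow> int \<Rightarrow> 'a \<Rightarrow> real" where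
  "B_row p \<tau> n' n \<alpha> = (\<Sum>\<beta>\<in>UNIV. Bmat p \<tau> n' n $ \<alpha> $ \<beta>)"

definition visited :: "'a::finite rows \<Rightarrow> real^'a \<Rightarrow> real^'a \<Rightarrow> int \<Rightarrow> int \<Rightarrow> 'a \<Rightarrow> nat \<Rightarrow> 'a" where
  "visited p \<tau> lam n' n \<alpha> j =
     (THE \<beta>. (iet (rows_at p \<tau> n') (lam_at p \<tau> lam n') ^^ j)
               ` iet_interval (rows_at p \<tau> n) (lam_at p \<tau> lam n) \<alpha>
             \<subseteq> iet_interval (rows_at p \<tau> n') (lam_at p \<tau> lam n') \<beta>)"

definition Sq :: "'a::finite rows \<Rightarrow> real^'a \<Rightarrow> real^'a \<Rightarrow> int \<Rightarrow> int \<Rightarrow> 'a \<Rightarrow> nat \<Rightarrow> real" where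
  "Sq p \<tau> lam n' n \<alpha> j = (\<Sum>i<j. q_at p \<tau> n' $ visited p \<tau> lam n' n \<alpha> i)"

definition S_sharp ::
  "'a::finite rows \<Rightarrow> real^'a \<Rightarrow> real^'a \<Rightarrow> int \<Rightarrow> int \<Rightarrow> ('a \<Rightarrow> real \<Rightarrow> real) \<Rightarrow> 'a \<Rightarrow> real \<Rightarrow> real"
where
  "S_sharp p \<tau> lam n n' \<psi> \<beta> x =
     (\<Sum>\<alpha>\<in>UNIV. \<Sum>j | real j < B_row p \<tau> n' n \<alpha> \<and> visited p \<tau> lam n' n \<alpha> j = \<beta>.
        \<psi> \<alpha> (x + Sq p \<tau> lam n' n \<alpha> j))"


subsection \<open>Function spaces on a disjoint union of sets\<close>

definition holder_on :: "('a \<Rightarrow> real set) \<Rightarrow> real \<Rightarrow> ('a \<Rightarrow> real \<Rightarrow> real) \<Rightarrow> bool" where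
  "holder_on D \<eta> \<psi> \<longleftrightarrow>
     (\<forall>\<alpha>. \<exists>K. \<forall>x\<in>D \<alpha>. \<forall>y\<in>D \<alpha>. \<bar>\<psi> \<alpha> x - \<psi> \<alpha> y\<bar> \<le> K * \<bar>x - y\<bar> powr \<eta>)"

text \<open>The suprema in the norms below are only used for bounded sets of numbers: a Hoelder continuous function
  on finitely many bounded intervals is bounded, and so are its dual Birkhoff sums.\<close>

definition C0_norm :: "('a \<Rightarrow> real set) \<Rightarrow> ('a \<Rightarrow> real \<Rightarrow> real) \<Rightarrow> real" where
  "C0_norm D \<psi> = Sup {\<bar>\<psi> \<alpha> x\<bar> | \<alpha> x. x \<in> D \<alpha>}"

definition holder_seminorm :: "('a \<Rightarrow> real set) \<Rightarrow> real \<Rightarrow> ('a \<Rightarrow> real \<Rightarrow> real) \<Rightarrow> real" where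
  "holder_seminorm D \<eta> \<psi> =
     Sup {\<bar>\<psi> \<alpha> x - \<psi> \<alpha> y\<bar> / \<bar>x - y\<bar> powr \<eta> | \<alpha> x y. x \<in> D \<alpha> \<and> y \<in> D \<alpha> \<and> x \<noteq> y}"

definition holder_norm :: "('a \<Rightarrow> real set) \<Rightarrow> real \<Rightarrow> ('a \<Rightarrow> real \<Rightarrow> real) \<Rightarrow> real" where
  "holder_norm D \<eta> \<psi> = C0_norm D \<psi> + holder_seminorm D \<eta> \<psi>"

definition mean_zero :: "('a::finite \<Rightarrow> real set) \<Rightarrow> ('a \<Rightarrow> real \<Rightarrow> real) \<Rightarrow> bool" where
  "mean_zero D \<psi> \<longleftrightarrow> (\<Sum>\<alpha>\<in>UNIV. integral (D \<alpha>) (\<psi> \<alpha>)) = 0"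

end

theory Submission
  imports Defs
begin

text \<open>
  The dual sum at a point of \<open>L\<^sub>\<beta>\<close> of time \<open>n\<close> has one term for every occurrence of \<open>\<beta>\<close> in the
  words that code the itineraries of the intervals \<open>I\<^sub>\<alpha>\<close> of time \<open>0\<close> under the interval exchange of
  time \<open>n\<close>. Let \<open>n \<le> m \<le> 0\<close>. Such a word arises from the itinerary at time \<open>m\<close> when every letter \<open>\<gamma>\<close>
  is replaced by its own itinerary at time \<open>n\<close>; accordingly \<open>L\<^sub>\<alpha>\<close> of time \<open>0\<close> is tiled by translates
  of the intervals \<open>L\<^sub>\<gamma>\<close> of time \<open>m\<close>. Replacing \<open>\<psi>\<close> by its mean on each tile changes each of the at
  most \<open>\<parallel>B(n,0)\<parallel>\<close> terms by at most the Hoelder seminorm times \<open>max q(m) powr \<eta>\<close>. What remains is the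
  vector \<open>B(n,m)\<^sup>T c\<close>, where \<open>c\<^sub>\<gamma>\<close> is the sum of the means over the tiles of type \<open>\<gamma>\<close>, and mean value
  zero says that \<open>c\<close> is orthogonal to \<open>q(m)\<close> (lemma \<open>dual_sum_decomposition\<close>).

  Write \<open>c = B(m,0)\<^sup>T v\<close>. Then \<open>v\<close> is orthogonal to \<open>q(0)\<close>, and \<open>B(n,m)\<^sup>T c = B(n,0)\<^sup>T v\<close> is bounded by
  condition (b), as soon as \<open>v\<close> is bounded in terms of \<open>c\<close> with a power of \<open>\<parallel>B(m,0)\<parallel>\<close> that does not
  depend on the number of letters. Lemma \<open>transpose_lower_bound\<close> gives the square: the identity
  \<open>\<Omega>(0) = B \<Omega>(m) B\<^sup>T\<close> bounds \<open>\<Omega>(0) v\<close>, that is \<open>v\<close> modulo the kernel of \<open>\<Omega>(0)\<close>, and on this kernel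
  the left endpoints of the (signed) intervals are the same in both rows and are invariant under the
  algorithm, so that \<open>B\<^sup>T\<close> is bounded below there. The same estimate yields \<open>\<theta> \<le> 3\<close>.

  Finally \<open>m\<close> is one of the times \<open>n_hat k\<close> of completeness: the earliest one in \<open>[n, 0]\<close> with
  \<open>\<parallel>B(m,0)\<parallel>\<close> at most of order \<open>\<parallel>B(n,0)\<parallel>\<close> to the power \<open>\<theta> / 4\<close>. A concatenation of \<open>2 d\<close> complete paths has a positive matrix,
  hence the heights \<open>q\<close> at \<open>n_hat k\<close> are at most of order \<open>1 / \<parallel>B(n_hat (k - 2 d), 0)\<parallel>\<close>, and by
  condition (a) the norms at \<open>n_hat (k - 2 d)\<close> and \<open>n_hat (k + 1)\<close> differ at most by a square. This
  gives \<open>q(m)\<close> of order at most \<open>\<parallel>B(n,0)\<parallel>\<close> to the power \<open>- \<theta> / 8\<close> (lemma \<open>intermediate_time\<close>).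
  The two parts of the sum have exponents \<open>1 - \<theta> \<eta> / 8\<close> and \<open>1 - \<theta> + 3 \<theta> / 4\<close>, both of which are at
  most \<open>1 - \<theta> \<eta> / 20\<close>.
\<close>

section \<open>One backward Rauzy--Veech step\<close>

abbreviation is_row :: "('a::finite \<Rightarrow> nat) \<Rightarrow> bool" where
  "is_row r \<equiv> bij_betw r UNIV {1..CARD('a)}"

text \<open>
  The matrix of an arrow and its transpose both act on vectors in this way, with the roles of
  winner and loser exchanged.
\<close>

definition add_entry :: "'a::finite \<Rightarrow> 'a \<Rightarrow> real^'a \<Rightarrow> real^'a" where
  "add_entry w l v = (\<chi> \<alpha>. if \<alpha> = w then v $ \<alpha> + v $ l else v $ \<alpha>)"

lemma row_eq_iff: "is_row r \<Longrightarrow> r \<alpha> = r \<beta> \<longleftrightarrow> \<alpha> = \<beta>"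
  by (metis UNIV_I bij_betw_inv_into_left)

lemma row_range: assumes "is_row (r :: 'a::finite \<Rightarrow> nat)" shows "1 \<le> r \<alpha>" "r \<alpha> \<le> CARD('a)"
  using bij_betwE[OF assms] by auto

lemma row_surj: "is_row (r :: 'a::finite \<Rightarrow> nat) \<Longrightarrow> 1 \<le> k \<Longrightarrow> k \<le> CARD('a) \<Longrightarrow> \<exists>\<alpha>. r \<alpha> = k"
  by (metis atLeastAtMost_iff bij_betw_def imageE)

text \<open>
  Arrows of top and bottom type differ only in which row is kept. Here \<open>r\<close> is the kept row and \<open>s\<close>
  the row in which the loser moves to the end.
\<close>

locale backward_arrow =
  fixes r s :: "'a::finite \<Rightarrow> nat" and w l :: 'a
  assumes row_r: "is_row r" and row_s: "is_row s"
    and w_last: "r w = CARD('a)" and l_next: "s l = s w + 1"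
begin

lemma w_neq_l: "w \<noteq> l"
  using l_next by auto

abbreviation "s' \<equiv> move_last l s"

lemma moved_l: "s' l = CARD('a)"
  by (simp add: move_last_def)

lemma moved_eq: "s \<alpha> \<le> s w \<Longrightarrow> s' \<alpha> = s \<alpha>"
  using l_next by (auto simp: move_last_def)

lemma moved_w: "s' w = s w"
  by (rule moved_eq) simp

lemma moved_less: "s \<alpha> > s w \<Longrightarrow> \<alpha> \<noteq> l \<Longrightarrow> s' \<alpha> = s \<alpha> - 1 \<and> s \<alpha> > s l"
  using l_next row_eq_iff[OF row_s, of \<alpha> l] by (auto simp: move_last_def)

lemma is_row_moved: "is_row s'"
proof -
  note rr = row_range[OF row_s]
  have "inj s'"
  proof (rule injI)
    fix x y assume e: "s' x = s' y"
    have lt: "s' z < CARD('a)" if "z \<noteq> l" for z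
    proof (cases "s z \<le> s w")
      case True
      then show ?thesis using moved_eq[of z] rr(2)[of l] l_next by simp
    next
      case False
      then show ?thesis using moved_less[of z] that rr(2)[of z] rr(1)[of l] by simp
    qed
    show "x = y"
    proof (cases "x = l \<or> y = l")
      case True
      then show ?thesis using e lt[of x] lt[of y] moved_l by (metis less_irrefl)
    next
      case False
      then have "s x = s y"
        using e rr(1)[of l] l_next row_eq_iff[OF row_s, of x l] row_eq_iff[OF row_s, of y l]
        by (auto simp: move_last_def split: if_splits)
      then show ?thesis using row_eq_iff[OF row_s] by blast
    qed
  qed
  moreover have "s' ` UNIV \<subseteq> {1..CARD('a)}"
  proof clarify
    fix x show "s' x \<in> {1..CARD('a)}"
      using rr(1)[of x] rr(2)[of x] rr(1)[of l] by (auto simp: move_last_def)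
  qed
  ultimately show ?thesis
    unfolding bij_betw_def
    by (metis card_atLeastAtMost card_image card_subset_eq diff_Suc_1 finite_atLeastAtMost)
qed

lemma sum_add_entry_notin: "w \<notin> A \<Longrightarrow> (\<Sum>\<beta>\<in>A. add_entry w l v $ \<beta>) = (\<Sum>\<beta>\<in>A. v $ \<beta>)"
  by (rule sum.cong) (auto simp: add_entry_def)

lemma sum_add_entry_minus:
  assumes "w \<in> A" "l \<in> A"
  shows "(\<Sum>\<beta>\<in>A - {l}. add_entry w l v $ \<beta>) = (\<Sum>\<beta>\<in>A. v $ \<beta>)"
proof -
  have "(\<Sum>\<beta>\<in>A - {l}. add_entry w l v $ \<beta>)
      = (\<Sum>\<beta>\<in>A - {l}. v $ \<beta> + (if \<beta> = w then v $ l else 0))"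
    by (rule sum.cong) (auto simp: add_entry_def)
  also have "\<dots> = (\<Sum>\<beta>\<in>A - {l}. v $ \<beta>) + v $ l"
    using assms w_neq_l by (simp add: sum.distrib)
  also have "\<dots> = (\<Sum>\<beta>\<in>A. v $ \<beta>)"
    using assms by (simp add: sum_diff1)
  finally show ?thesis .
qed

lemma sum_kept: "k \<le> CARD('a) \<Longrightarrow> (\<Sum>\<beta> | r \<beta> < k. add_entry w l v $ \<beta>) = (\<Sum>\<beta> | r \<beta> < k. v $ \<beta>)"
  by (rule sum_add_entry_notin) (simp add: w_last)

lemma less_moved_low: "k \<le> s w \<Longrightarrow> {\<beta>. s' \<beta> < k} = {\<beta>. s \<beta> < k}"
  using l_next row_range[OF row_s, of l] by (auto simp: move_last_def split: if_splits)

lemma less_moved_high: 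
  assumes "k > s w" "k \<le> CARD('a)"
  shows "{\<beta>. s' \<beta> < k} = {\<beta>. s \<beta> < k + 1} - {l}" "w \<in> {\<beta>. s \<beta> < k + 1}" "l \<in> {\<beta>. s \<beta> < k + 1}"
proof -
  have "s' \<beta> < k \<longleftrightarrow> s \<beta> < k + 1 \<and> \<beta> \<noteq> l" for \<beta>
  proof (cases "s \<beta> \<le> s w")
    case True
    then show ?thesis using moved_eq[OF True] assms l_next by auto
  next
    case False
    then show ?thesis using moved_less[of \<beta>] moved_l assms by (cases "\<beta> = l") auto
  qed
  then show "{\<beta>. s' \<beta> < k} = {\<beta>. s \<beta> < k + 1} - {l}" by auto
qed (use assms l_next in auto)

lemma sum_moved_low: "k \<le> s w \<Longrightarrow> (\<Sum>\<beta> | s' \<beta> < k. add_entry w l v $ \<beta>) = (\<Sum>\<beta> | s \<beta> < k. v $ \<beta>)"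
  unfolding less_moved_low by (rule sum_add_entry_notin) simp

lemma sum_moved_high:
  "s w < k \<Longrightarrow> k \<le> CARD('a) \<Longrightarrow> (\<Sum>\<beta> | s' \<beta> < k. add_entry w l v $ \<beta>) = (\<Sum>\<beta> | s \<beta> < k + 1. v $ \<beta>)"
  using less_moved_high[of k] sum_add_entry_minus[of "{\<beta>. s \<beta> < k + 1}" v] by presburger

text \<open>
  The endpoint formulas of this section serve three kinds of vectors: length data, where they
  describe the interval exchange; suspension data, where they describe the heights \<open>q\<close>; and arbitrary
  vectors, where they give the invariance of \<open>Omega\<close> and of its kernel.
\<close>

lemma left_kept: "iet_left r (add_entry w l v) \<alpha> = iet_left r v \<alpha>"
  unfolding iet_left_def by (rule sum_kept[OF row_range(2)[OF row_r]])

lemma left_moved: assumes "\<alpha> \<noteq> l" shows "iet_left s' (add_entry w l v) \<alpha> = iet_left s v \<alpha>"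
proof (cases "s \<alpha> \<le> s w")
  case True
  then show ?thesis unfolding iet_left_def using sum_moved_low[OF True] moved_eq[OF True] by simp
next
  case False
  then have "s' \<alpha> = s \<alpha> - 1" "s l < s \<alpha>" using moved_less[of \<alpha>] assms by auto
  then show ?thesis
    unfolding iet_left_def using sum_moved_high[of "s \<alpha> - 1" v] row_range[OF row_s, of \<alpha>] l_next by simp
qed

lemma left_moved_loser: "iet_left s' (add_entry w l v) l = (\<Sum>\<beta>\<in>UNIV. v $ \<beta>)"
proof -
  have "{\<beta>. s \<beta> < CARD('a) + 1} = UNIV" using row_range[OF row_s] by (auto simp: less_Suc_eq_le)
  then show ?thesis
    unfolding iet_left_def moved_l using sum_moved_high[of "CARD('a)" v] row_range(2)[OF row_s, of l] l_next
    by simp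
qed

lemma left_w: "iet_left r v w = (\<Sum>\<beta>\<in>UNIV. v $ \<beta>) - v $ w"
proof -
  have "r \<beta> < r w \<longleftrightarrow> \<beta> \<noteq> w" for \<beta>
    using row_range(2)[OF row_r, of \<beta>] row_eq_iff[OF row_r, of \<beta> w] w_last by linarith
  then have "{\<beta>. r \<beta> < r w} = UNIV - {w}" by auto
  then show ?thesis by (simp add: iet_left_def sum_diff1)
qed

end

lemma left_succ:
  assumes "is_row s" "s b = s a + 1"
  shows "iet_left s v b = iet_left s v a + v $ a"
proof -
  have "{\<beta>. s \<beta> < s b} = insert a {\<beta>. s \<beta> < s a}"
    using assms row_eq_iff[OF assms(1)] by (auto simp: less_Suc_eq)
  then show ?thesis by (simp add: iet_left_def)
qed

lemma left_bound: "\<bar>iet_left s v \<alpha>\<bar> \<le> (\<Sum>\<beta>\<in>UNIV. \<bar>v $ \<beta>\<bar>)"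
  unfolding iet_left_def by (rule order_trans[OF sum_abs sum_mono2]) auto

text \<open>
  The entries of \<open>Omega p *v v\<close> are the translation lengths of the formal interval exchange with
  lengths \<open>v\<close>.
\<close>

lemma Omega_mult:
  assumes "is_row (fst p)" "is_row (snd p)"
  shows "(Omega p *v v) $ \<alpha> = iet_left (snd p) v \<alpha> - iet_left (fst p) v \<alpha>"
proof -
  have "(Omega p *v v) $ \<alpha> = (\<Sum>\<beta>\<in>UNIV. (if snd p \<beta> < snd p \<alpha> then v $ \<beta> else 0)
      - (if fst p \<beta> < fst p \<alpha> then v $ \<beta> else 0))"
    unfolding matrix_vector_mult_def Omega_def
  proof (simp, intro sum.cong refl)
    fix \<beta>
    show "(if fst p \<alpha> < fst p \<beta> \<and> snd p \<beta> < snd p \<alpha> then 1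
           else if fst p \<beta> < fst p \<alpha> \<and> snd p \<alpha> < snd p \<beta> then - 1 else 0) * v $ \<beta> =
         (if snd p \<beta> < snd p \<alpha> then v $ \<beta> else 0) - (if fst p \<beta> < fst p \<alpha> then v $ \<beta> else 0)"
      using row_eq_iff[OF assms(1), of \<alpha> \<beta>] row_eq_iff[OF assms(2), of \<alpha> \<beta>]
      by (cases "\<alpha> = \<beta>"; cases "fst p \<alpha> < fst p \<beta>"; cases "snd p \<alpha> < snd p \<beta>") auto
  qed
  also have "\<dots> = iet_left (snd p) v \<alpha> - iet_left (fst p) v \<alpha>"
    unfolding sum_subtractf iet_left_def by (simp add: sum.If_cases)
  finally show ?thesis .
qed


section \<open>The backward orbit and the invariance of the form \<open>Omega\<close>\<close>

lemma irreducible_swap: "irreducible_rows (r, s) \<longleftrightarrow> irreducible_rows (s, r)"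
  unfolding irreducible_rows_def fst_conv snd_conv by metis

text \<open>
  Consequently the winner has a right neighbour in the other row, which makes the loser well defined.
\<close>

lemma irreducible_last:
  assumes "CARD('a) \<ge> 2" "irreducible_rows (r, s :: 'a::finite \<Rightarrow> nat)" "r a = CARD('a)"
  shows "s a \<noteq> CARD('a)"
proof
  assume a: "s a = CARD('a)"
  have rows: "is_row r" "is_row s" using assms(2) by (auto simp: irreducible_rows_def)
  have vim: "u -` {1..CARD('a) - 1} = UNIV - {a}" if "is_row u" "u a = CARD('a)" for u :: "'a \<Rightarrow> nat"
  proof -
    have "u b \<in> {1..CARD('a) - 1} \<longleftrightarrow> b \<noteq> a" for b
    proof -
      have "u b = CARD('a) \<longleftrightarrow> b = a" using row_eq_iff[OF that(1), of b a] that(2) by simp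
      moreover have "1 \<le> u b" "u b \<le> CARD('a)" by (rule row_range[OF that(1)])+
      moreover have "1 \<le> m \<Longrightarrow> m \<le> n \<Longrightarrow> m \<in> {1..n - 1} \<longleftrightarrow> m \<noteq> n" for m n :: nat by auto
      ultimately show ?thesis by metis
    qed
    then show ?thesis by (intro set_eqI) (simp only: vimage_eq Diff_iff UNIV_I singleton_iff simp_thms)
  qed
  have "r -` {1..CARD('a) - 1} = s -` {1..CARD('a) - 1}"
    using vim[OF rows(1) assms(3)] vim[OF rows(2) a] by simp
  moreover have "1 \<le> CARD('a) - 1" "CARD('a) - 1 < CARD('a)" using assms(1) by auto
  ultimately show False using assms(2) unfolding irreducible_rows_def by (metis fst_conv snd_conv)
qed

lemma irreducible_first:
  assumes "CARD('a) \<ge> 2" "irreducible_rows (r, s :: 'a::finite \<Rightarrow> nat)" "r a = 1"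
  shows "s a \<noteq> 1"
proof
  assume a: "s a = 1"
  have rows: "is_row r" "is_row s" using assms(2) by (auto simp: irreducible_rows_def)
  have vim: "u -` {1..1} = {a}" if "is_row u" "u a = 1" for u :: "'a \<Rightarrow> nat"
    using row_eq_iff[OF that(1), of _ a] that(2) by auto
  have "r -` {1..1} = s -` {1..1}"
    using vim[OF rows(1) assms(3)] vim[OF rows(2) a] by simp
  moreover have "1 < CARD('a)" using assms(1) by auto
  ultimately show False using assms(2) unfolding irreducible_rows_def by (metis fst_conv snd_conv order_refl)
qed

context backward_arrow
begin

text \<open>
  An initial segment common to the new rows cannot contain the winner, which is last in \<open>r\<close>. It
  therefore ends before the winner in \<open>s'\<close>, where \<open>s\<close> and \<open>s'\<close> agree, and is common to the old rows.
\<close>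

lemma irreducible_moved:
  assumes "irreducible_rows (r, s)"
  shows "irreducible_rows (r, s')"
proof -
  have "r -` {1..k} \<noteq> s' -` {1..k}" if k: "1 \<le> k" "k < CARD('a)" for k
  proof
    assume e: "r -` {1..k} = s' -` {1..k}"
    have "w \<notin> r -` {1..k}" using w_last k by simp
    then have "s w > k" using e moved_w row_range(1)[OF row_s, of w] by auto
    then have "{\<beta>. s' \<beta> < k + 1} = {\<beta>. s \<beta> < k + 1}" by (intro less_moved_low) simp
    moreover have "u -` {1..k} = {\<beta>. u \<beta> < k + 1}" if "is_row u" for u :: "'a \<Rightarrow> nat"
      using row_range(1)[OF that] by auto
    ultimately have "s' -` {1..k} = s -` {1..k}" using row_s is_row_moved by simp
    then show False using e assms k by (auto simp: irreducible_rows_def)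
  qed
  then show ?thesis using row_r is_row_moved by (auto simp: irreducible_rows_def)
qed

text \<open>
  Up to the winner the partial sums do not change; beyond it the winner has absorbed the entry of the
  loser, and a partial sum of the new row is the old one with one more place. Only the longest of these
  is the total sum, whose sign is the type of the arrow. This is why \<open>Theta\<close> is preserved.
\<close>

lemma moved_partial_sum:
  assumes "1 < k" "k \<le> CARD('a)"
  obtains k' where "1 < k'" "k' \<le> CARD('a)"
      "(\<Sum>\<beta> | s' \<beta> < k. add_entry w l v $ \<beta>) = (\<Sum>\<beta> | s \<beta> < k'. v $ \<beta>)"
    | "(\<Sum>\<beta> | s' \<beta> < k. add_entry w l v $ \<beta>) = (\<Sum>\<beta>\<in>UNIV. v $ \<beta>)"
proof -
  consider "k \<le> s w" | "s w < k" "k < CARD('a)" | "s w < k" "k = CARD('a)" using assms by linarith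
  then show ?thesis
  proof cases
    case 1
    show ?thesis using sum_moved_low[OF 1, of v] assms that(1)[of k] by simp
  next
    case 2
    show ?thesis using sum_moved_high[of k v] 2 assms that(1)[of "k + 1"] by simp
  next
    case 3
    have "{\<beta>. s \<beta> < CARD('a) + 1} = UNIV" using row_range[OF row_s] by (auto simp: less_Suc_eq_le)
    then show ?thesis using sum_moved_high[of k v] 3 that(2) by simp
  qed
qed

end

text \<open>
  The natural number \<open>k\<close> stands for the time \<open>- k\<close>, and \<open>M i j\<close> below is the matrix \<open>B(-i-j, -i)\<close>.
\<close>

locale backward_orbit =
  fixes p :: "'a::finite rows" and \<tau> :: "real^'a"
  assumes two_letters: "CARD('a) \<ge> 2"
    and irreducible: "irreducible_rows p"
    and Theta: "\<tau> \<in> Theta p"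
    and backward_defined: "backward_defined p \<tau>"
begin

abbreviation "R k \<equiv> rows_at p \<tau> (- int k)"
abbreviation "T k \<equiv> tau_at p \<tau> (- int k)"
abbreviation "win k \<equiv> arrow_winner p \<tau> (- int k)"
abbreviation "los k \<equiv> arrow_loser p \<tau> (- int k)"
abbreviation "A k \<equiv> arrow_matrix p \<tau> (- int k)"
abbreviation "q k \<equiv> q_at p \<tau> (- int k)"
abbreviation "M i j \<equiv> B_back p \<tau> (- int i) j"

lemma R_0: "R 0 = p" and T_0: "T 0 = \<tau>"
  by (simp_all add: rows_at_def tau_at_def)

lemma R_Suc: "R (Suc k) = prev_rows (R k) (T k)" and T_Suc_prev: "T (Suc k) = prev_vec (R k) (T k) (T k)"
proof -
  have n: "nat (- (- int (Suc k))) = Suc k" by simp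
  show "R (Suc k) = prev_rows (R k) (T k)" "T (Suc k) = prev_vec (R k) (T k) (T k)"
    unfolding rows_at_def tau_at_def n by (simp_all add: rv_step_def case_prod_beta)
qed

lemma prev_vec_eq: "prev_vec (R k) (T k) v = add_entry (win k) (los k) v"
  by (simp add: prev_vec_def add_entry_def arrow_winner_def arrow_loser_def)

lemma T_Suc: "T (Suc k) = add_entry (win k) (los k) (T k)"
  by (simp only: T_Suc_prev prev_vec_eq)

lemma T_sum: "(\<Sum>\<alpha>\<in>UNIV. T k $ \<alpha>) \<noteq> 0"
  using backward_defined by (simp add: backward_defined_def)

lemma the_last: "is_row (r :: 'a \<Rightarrow> nat) \<Longrightarrow> r (THE \<alpha>. r \<alpha> = CARD('a)) = CARD('a)"
  by (rule theI') (use row_surj[of r "CARD('a)"] row_eq_iff[of r] two_letters in \<open>metis One_nat_def Suc_leI order_refl zero_less_card_finite\<close>)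

lemma the_next:
  assumes "is_row (r :: 'a \<Rightarrow> nat)" "r a \<noteq> CARD('a)"
  shows "r (THE \<alpha>. r \<alpha> = r a + 1) = r a + 1"
proof -
  have "\<exists>b. r b = r a + 1"
    using row_surj[OF assms(1), of "r a + 1"] row_range(2)[OF assms(1), of a] assms(2) by simp
  then show ?thesis using row_eq_iff[OF assms(1)] 
    by (intro theI'[of "\<lambda>\<alpha>. r \<alpha> = r a + 1"]) metis
qed

lemma top_arrow:
  assumes "irreducible_rows (R k)" "top_type (T k)"
  shows "backward_arrow (fst (R k)) (snd (R k)) (win k) (los k)"
    and "R (Suc k) = (fst (R k), move_last (los k) (snd (R k)))"
proof -
  have rows: "is_row (fst (R k))" "is_row (snd (R k))" using assms by (auto simp: irreducible_rows_def)
  have w: "fst (R k) (win k) = CARD('a)"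
    unfolding arrow_winner_def winner_def using assms(2) the_last[OF rows(1)] by simp
  have "snd (R k) (win k) \<noteq> CARD('a)"
    using irreducible_last[OF two_letters, of "fst (R k)" "snd (R k)"] w assms(1) by (metis prod.collapse)
  from the_next[OF rows(2) this] have "snd (R k) (los k) = snd (R k) (win k) + 1"
    unfolding arrow_loser_def loser_def using assms(2) by (simp add: arrow_winner_def)
  then show "backward_arrow (fst (R k)) (snd (R k)) (win k) (los k)"
    using rows w by unfold_locales
  show "R (Suc k) = (fst (R k), move_last (los k) (snd (R k)))"
    using assms(2) unfolding R_Suc by (simp add: prev_rows_def arrow_loser_def)
qed

lemma bottom_arrow:
  assumes "irreducible_rows (R k)" "\<not> top_type (T k)"
  shows "backward_arrow (snd (R k)) (fst (R k)) (win k) (los k)"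
    and "R (Suc k) = (move_last (los k) (fst (R k)), snd (R k))"
proof -
  have rows: "is_row (fst (R k))" "is_row (snd (R k))" using assms by (auto simp: irreducible_rows_def)
  have w: "snd (R k) (win k) = CARD('a)"
    unfolding arrow_winner_def winner_def using assms(2) the_last[OF rows(2)] by simp
  have "fst (R k) (win k) \<noteq> CARD('a)"
    using irreducible_last[OF two_letters, of "snd (R k)" "fst (R k)"] w assms(1) irreducible_swap by (metis prod.collapse)
  from the_next[OF rows(1) this] have "fst (R k) (los k) = fst (R k) (win k) + 1"
    unfolding arrow_loser_def loser_def using assms(2) by (simp add: arrow_winner_def)
  then show "backward_arrow (snd (R k)) (fst (R k)) (win k) (los k)"
    using rows w by unfold_locales
  show "R (Suc k) = (move_last (los k) (fst (R k)), snd (R k))"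
    using assms(2) unfolding R_Suc by (simp add: prev_rows_def arrow_loser_def)
qed

lemma orbit_invariant: "irreducible_rows (R k) \<and> T k \<in> Theta (R k)"
proof (induction k)
  case 0
  then show ?case using irreducible Theta by (simp add: R_0[simplified] T_0[simplified])
next
  case (Suc k)
  then have irr: "irreducible_rows (R k)"
    and pos: "\<And>j. 1 < j \<Longrightarrow> j \<le> CARD('a) \<Longrightarrow> (\<Sum>\<alpha> | fst (R k) \<alpha> < j. T k $ \<alpha>) > 0"
    and neg: "\<And>j. 1 < j \<Longrightarrow> j \<le> CARD('a) \<Longrightarrow> (\<Sum>\<alpha> | snd (R k) \<alpha> < j. T k $ \<alpha>) < 0"
    by (auto simp: Theta_def)
  show ?case
  proof (cases "top_type (T k)")
    case True
    interpret backward_arrow "fst (R k)" "snd (R k)" "win k" "los k" by (rule top_arrow[OF irr True])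
    have tot: "(\<Sum>\<beta>\<in>UNIV. T k $ \<beta>) < 0" using True by (simp add: top_type_def)
    have "irreducible_rows (R (Suc k))"
      unfolding top_arrow(2)[OF irr True] using irreducible_moved irr by simp
    moreover have "T (Suc k) \<in> Theta (R (Suc k))"
      unfolding top_arrow(2)[OF irr True] T_Suc Theta_def mem_Collect_eq fst_conv snd_conv
    proof (intro allI impI conjI; elim conjE)
      fix j :: nat assume j: "1 < j" "j \<le> CARD('a)"
      show "(\<Sum>\<alpha> | fst (R k) \<alpha> < j. add_entry (win k) (los k) (T k) $ \<alpha>) > 0"
        using sum_kept[OF j(2)] pos[OF j] by simp
      show "(\<Sum>\<alpha> | s' \<alpha> < j. add_entry (win k) (los k) (T k) $ \<alpha>) < 0"
        by (rule moved_partial_sum[OF j, of "T k"]) (use neg tot in auto)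
    qed
    ultimately show ?thesis by simp
  next
    case False
    interpret backward_arrow "snd (R k)" "fst (R k)" "win k" "los k" by (rule bottom_arrow[OF irr False])
    have tot: "(\<Sum>\<beta>\<in>UNIV. T k $ \<beta>) > 0" using False T_sum[of k] by (simp add: top_type_def)
    have "irreducible_rows (R (Suc k))"
      unfolding bottom_arrow(2)[OF irr False] using irreducible_moved irr irreducible_swap by (metis prod.collapse)
    moreover have "T (Suc k) \<in> Theta (R (Suc k))"
      unfolding bottom_arrow(2)[OF irr False] T_Suc Theta_def mem_Collect_eq fst_conv snd_conv
    proof (intro allI impI conjI; elim conjE)
      fix j :: nat assume j: "1 < j" "j \<le> CARD('a)"
      show "(\<Sum>\<alpha> | snd (R k) \<alpha> < j. add_entry (win k) (los k) (T k) $ \<alpha>) < 0"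
        using sum_kept[OF j(2)] neg[OF j] by simp
      show "(\<Sum>\<alpha> | s' \<alpha> < j. add_entry (win k) (los k) (T k) $ \<alpha>) > 0"
        by (rule moved_partial_sum[OF j, of "T k"]) (use pos tot in auto)
    qed
    ultimately show ?thesis by simp
  qed
qed

lemma irr_R: "irreducible_rows (R k)"
  using orbit_invariant by blast

lemma row_fst: "is_row (fst (R k))" and row_snd: "is_row (snd (R k))"
  using irr_R[of k] by (auto simp: irreducible_rows_def)

lemma arrow_cases [case_names top bottom]:
  obtains
    "top_type (T k)" "backward_arrow (fst (R k)) (snd (R k)) (win k) (los k)"
      "R (Suc k) = (fst (R k), move_last (los k) (snd (R k)))"
  | "\<not> top_type (T k)" "backward_arrow (snd (R k)) (fst (R k)) (win k) (los k)"
      "R (Suc k) = (move_last (los k) (fst (R k)), snd (R k))"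
  using top_arrow[OF irr_R] bottom_arrow[OF irr_R] by blast

lemma winner_neq_loser: "win k \<noteq> los k"
  by (rule arrow_cases[of k]) (auto dest: backward_arrow.w_neq_l)

lemma winner_last: "fst (R k) (win k) = CARD('a) \<or> snd (R k) (win k) = CARD('a)"
  by (rule arrow_cases[of k]) (auto dest: backward_arrow.w_last)

text \<open>
  After an arrow the two rows end with its winner and its loser, and the next winner is one of the last
  letters.
\<close>

lemma next_winner: "win (Suc k) = win k \<or> win (Suc k) = los k"
proof -
  have lasts: "fst (R (Suc k)) (win k) = CARD('a) \<and> snd (R (Suc k)) (los k) = CARD('a) \<or>
     snd (R (Suc k)) (win k) = CARD('a) \<and> fst (R (Suc k)) (los k) = CARD('a)"
    by (rule arrow_cases[of k])
      (auto dest: backward_arrow.w_last simp del: of_nat_Suc simp add: move_last_def)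
  show ?thesis
    using lasts winner_last[of "Suc k"] row_eq_iff[OF row_fst[of "Suc k"]] row_eq_iff[OF row_snd[of "Suc k"]]
    by metis
qed

lemma q_coord: "q k $ \<alpha> = iet_left (fst (R k)) (T k) \<alpha> - iet_left (snd (R k)) (T k) \<alpha>"
  unfolding q_at_def using Omega_mult[OF row_fst row_snd] by simp

text \<open>
  By \<open>Theta\<close> the left endpoints of \<open>T k\<close> are positive in the top row and negative in the bottom row,
  except that the first letter of a row has endpoint \<open>0\<close>; no letter is first in both rows.
\<close>

lemma q_pos: "q k $ \<alpha> > 0"
proof -
  let ?f = "fst (R k)" and ?s = "snd (R k)"
  have th: "1 < j \<Longrightarrow> j \<le> CARD('a) \<Longrightarrow> (\<Sum>\<beta> | ?f \<beta> < j. T k $ \<beta>) > 0 \<and> (\<Sum>\<beta> | ?s \<beta> < j. T k $ \<beta>) < 0" for j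
    using orbit_invariant[of k] by (auto simp: Theta_def)
  have f: "iet_left ?f (T k) \<alpha> > 0" if "?f \<alpha> \<noteq> 1"
    using th[of "?f \<alpha>"] that row_range[OF row_fst, of k \<alpha>] by (simp add: iet_left_def)
  have s: "iet_left ?s (T k) \<alpha> < 0" if "?s \<alpha> \<noteq> 1"
    using th[of "?s \<alpha>"] that row_range[OF row_snd, of k \<alpha>] by (simp add: iet_left_def)
  have z: "iet_left u (T k) \<alpha> = 0" if "is_row u" "u \<alpha> = 1" for u
  proof -
    have "{\<beta>. u \<beta> < u \<alpha>} = {}" unfolding that(2) using row_range(1)[OF that(1)] by (metis (mono_tags) empty_Collect_eq not_less)
    then show ?thesis by (simp add: iet_left_def)
  qed
  have "?f \<alpha> = 1 \<Longrightarrow> ?s \<alpha> \<noteq> 1"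
    using irreducible_first[OF two_letters, of ?f ?s \<alpha>] irr_R[of k] by simp
  then show ?thesis
    unfolding q_coord using f s z[OF row_fst] z[OF row_snd] by (cases "?f \<alpha> = 1"; cases "?s \<alpha> = 1") auto
qed

lemma A_entry: "A k $ \<alpha> $ \<beta> = (if \<alpha> = \<beta> then 1 else 0) + (if \<alpha> = los k \<and> \<beta> = win k then 1 else 0)"
  by (simp add: arrow_matrix_def mat_def)

lemma A_mult: "A k *v v = add_entry (los k) (win k) v"
proof -
  have "(A k *v v) $ \<alpha> = add_entry (los k) (win k) v $ \<alpha>" for \<alpha>
  proof -
    have "(A k *v v) $ \<alpha> = (\<Sum>\<beta>\<in>UNIV. (if \<alpha> = \<beta> then v $ \<beta> else 0) + (if \<beta> = win k then (if \<alpha> = los k then v $ \<beta> else 0) else 0))"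
      unfolding matrix_vector_mult_def by (simp add: A_entry, intro sum.cong) auto
    then show ?thesis by (simp add: sum.distrib add_entry_def)
  qed
  then show ?thesis by (simp add: vec_eq_iff)
qed

lemma A_transpose_mult: "transpose (A k) *v v = add_entry (win k) (los k) v"
proof -
  have "(transpose (A k) *v v) $ \<alpha> = add_entry (win k) (los k) v $ \<alpha>" for \<alpha>
  proof -
    have "(transpose (A k) *v v) $ \<alpha> = (\<Sum>\<beta>\<in>UNIV. (if \<alpha> = \<beta> then v $ \<beta> else 0) + (if \<beta> = los k then (if \<alpha> = win k then v $ \<beta> else 0) else 0))"
      unfolding matrix_vector_mult_def by (simp add: A_entry transpose_def, intro sum.cong) auto
    then show ?thesis by (simp add: sum.distrib add_entry_def)
  qed
  then show ?thesis by (simp add: vec_eq_iff)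
qed

lemma left_step:
  defines "v' v k \<equiv> add_entry (win k) (los k) v"
  shows "\<alpha> \<noteq> los k \<Longrightarrow> iet_left (fst (R (Suc k))) (v' v k) \<alpha> = iet_left (fst (R k)) v \<alpha>"
    and "\<alpha> \<noteq> los k \<Longrightarrow> iet_left (snd (R (Suc k))) (v' v k) \<alpha> = iet_left (snd (R k)) v \<alpha>"
  by (rule arrow_cases[of k]; simp add: v'_def backward_arrow.left_kept backward_arrow.left_moved)+

text \<open>
  In a row where the loser moves, its new left endpoint is the total sum, which is the right endpoint
  of the winner in the other row; in its old position the loser is adjacent to the winner.
\<close>

lemma left_step_loser:
  fixes v k
  defines "v' \<equiv> add_entry (win k) (los k) v"
  obtains
    "top_type (T k)"
    "iet_left (fst (R (Suc k))) v' (los k) = iet_left (fst (R k)) v (los k)"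
    "iet_left (snd (R (Suc k))) v' (los k) = (\<Sum>\<beta>\<in>UNIV. v $ \<beta>)"
    "iet_left (fst (R k)) v (win k) = (\<Sum>\<beta>\<in>UNIV. v $ \<beta>) - v $ win k"
    "iet_left (snd (R k)) v (los k) = iet_left (snd (R k)) v (win k) + v $ win k"
  | "\<not> top_type (T k)"
    "iet_left (snd (R (Suc k))) v' (los k) = iet_left (snd (R k)) v (los k)"
    "iet_left (fst (R (Suc k))) v' (los k) = (\<Sum>\<beta>\<in>UNIV. v $ \<beta>)"
    "iet_left (snd (R k)) v (win k) = (\<Sum>\<beta>\<in>UNIV. v $ \<beta>) - v $ win k"
    "iet_left (fst (R k)) v (los k) = iet_left (fst (R k)) v (win k) + v $ win k"
proof (cases rule: arrow_cases[of k])
  case top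
  then interpret backward_arrow "fst (R k)" "snd (R k)" "win k" "los k" by simp
  show ?thesis
    by (rule that(1)) (use top left_kept left_moved_loser left_w left_succ[OF row_s l_next] in \<open>simp_all add: v'_def\<close>)
next
  case bottom
  then interpret backward_arrow "snd (R k)" "fst (R k)" "win k" "los k" by simp
  show ?thesis
    by (rule that(2)) (use bottom left_kept left_moved_loser left_w left_succ[OF row_s l_next] in \<open>simp_all add: v'_def\<close>)
qed

lemma Omega_step: "Omega (R k) *v v = A k *v (Omega (R (Suc k)) *v (transpose (A k) *v v))"
proof -
  let ?v = "add_entry (win k) (los k) v"
  have "(Omega (R k) *v v) $ \<alpha> = add_entry (los k) (win k) (Omega (R (Suc k)) *v ?v) $ \<alpha>" for \<alpha>
  proof (cases "\<alpha> = los k")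
    case False
    then show ?thesis
      using left_step[OF False, of v] by (simp add: add_entry_def Omega_mult[OF row_fst row_snd] del: of_nat_Suc)
  next
    case True
    show ?thesis
      unfolding True
      by (rule left_step_loser[of k v])
        (use left_step[OF winner_neq_loser, of k v] in
          \<open>simp_all add: add_entry_def Omega_mult[OF row_fst row_snd] del: of_nat_Suc\<close>)
  qed
  then show ?thesis unfolding A_mult A_transpose_mult vec_eq_iff by blast
qed

text \<open>
  If \<open>v\<close> has the same left endpoints in both rows, then the right endpoint of the winner is at once
  the total sum (kept row) and the left endpoint of the loser (other row). So not even the endpoint of
  the moving loser changes.
\<close>

lemma kernel_step:
  assumes "\<And>\<alpha>. iet_left (fst (R k)) v \<alpha> = x \<alpha>" "\<And>\<alpha>. iet_left (snd (R k)) v \<alpha> = x \<alpha>"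
  shows "iet_left (fst (R (Suc k))) (transpose (A k) *v v) \<alpha> = x \<alpha>"
    and "iet_left (snd (R (Suc k))) (transpose (A k) *v v) \<alpha> = x \<alpha>"
proof -
  show "iet_left (fst (R (Suc k))) (transpose (A k) *v v) \<alpha> = x \<alpha>"
    unfolding A_transpose_mult using left_step(1)[of \<alpha> k v] assms
    by (cases "\<alpha> = los k"; cases rule: left_step_loser[of k v]) (simp_all del: of_nat_Suc)
  show "iet_left (snd (R (Suc k))) (transpose (A k) *v v) \<alpha> = x \<alpha>"
    unfolding A_transpose_mult using left_step(2)[of \<alpha> k v] assms
    by (cases "\<alpha> = los k"; cases rule: left_step_loser[of k v]) (simp_all del: of_nat_Suc)
qed

lemma q_step: "q k = A k *v q (Suc k)"
  unfolding q_at_def T_Suc A_transpose_mult[symmetric] using Omega_step[of k "T k"]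
  linear_neg[OF matrix_vector_mul_linear]
  by metis

lemma M_Suc: "M i (Suc j) = M i j ** A (i + j)"
  by (simp add: algebra_simps)

lemma M_add: "M i (j + j') = M i j ** M (i + j) j'"
proof (induction j')
  case (Suc j')
  have "M i (j + Suc j') = M i (j + j') ** A (i + (j + j'))" using M_Suc[of i "j + j'"] by simp
  also have "\<dots> = M i j ** (M (i + j) j' ** A (i + j + j'))" 
    using Suc by (simp add: matrix_mul_assoc add.assoc)
  finally show ?case using M_Suc[of "i + j" j'] by simp
qed simp

lemma q_M: "q i = M i j *v q (i + j)"
proof (induction j)
  case (Suc j)
  then show ?case using q_step[of "i + j"] M_Suc[of i j]
    by (simp add: matrix_vector_mul_assoc del: of_nat_Suc B_back.simps of_nat_add)
qed simp

lemma Omega_M: "Omega (R i) *v v = M i j *v (Omega (R (i + j)) *v (transpose (M i j) *v v))"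
proof (induction j)
  case 0
  then show ?case by simp
next
  case (Suc j)
  then show ?case using Omega_step[of "i + j" "transpose (M i j) *v v"] 
    unfolding M_Suc matrix_transpose_mul
    by (simp add: matrix_vector_mul_assoc[symmetric] del: of_nat_Suc B_back.simps of_nat_add)
qed

lemma kernel_M:
  assumes "\<And>\<alpha>. iet_left (fst (R i)) v \<alpha> = x \<alpha>" "\<And>\<alpha>. iet_left (snd (R i)) v \<alpha> = x \<alpha>"
  shows "iet_left (fst (R (i + j))) (transpose (M i j) *v v) \<alpha> = x \<alpha> \<and>
         iet_left (snd (R (i + j))) (transpose (M i j) *v v) \<alpha> = x \<alpha>"
proof (induction j arbitrary: \<alpha>)
  case 0
  then show ?case using assms by simp
next
  case (Suc j)
  then show ?case using kernel_step[of "i + j" "transpose (M i j) *v v" x \<alpha>]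
    unfolding M_Suc matrix_transpose_mul
    by (simp add: matrix_vector_mul_assoc[symmetric] del: of_nat_Suc B_back.simps of_nat_add)
qed

end


section \<open>Coding words and dual Birkhoff sums\<close>

lemma sum_list_eq_sum_count:
  fixes g :: "'a::finite \<Rightarrow> real"
  shows "sum_list (map g ws) = (\<Sum>a\<in>UNIV. real (count_list ws a) * g a)"
proof (induction ws)
  case (Cons b ws)
  have "(\<Sum>a\<in>UNIV. real (count_list (b # ws) a) * g a)
      = (\<Sum>a\<in>UNIV. (if a = b then g a else 0) + real (count_list ws a) * g a)"
    by (intro sum.cong) (auto simp: algebra_simps)
  then show ?case using Cons by (simp add: sum.distrib)
qed simp

lemma count_list_concat_map:
  "real (count_list (concat (map f ws)) b) = sum_list (map (\<lambda>a. real (count_list (f a) b)) ws)"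
  by (induction ws) simp_all

lemma concat_map_concat_map:
  "concat (map f (concat (map g ws))) = concat (map (\<lambda>a. concat (map f (g a))) ws)"
  by (induction ws) simp_all

context backward_orbit
begin

text \<open>
  The points of the new interval of a letter return after one step, except for those of the loser. For
  an arrow of top type the latter start in the loser interval of the larger exchange and are mapped to
  the end of the winner interval; for bottom type they start at the end of the winner interval.
\<close>

definition sub_word :: "nat \<Rightarrow> 'a \<Rightarrow> 'a list" where
  "sub_word k \<gamma> =
     (if \<gamma> = los k then if top_type (T k) then [los k, win k] else [win k, los k] else [\<gamma>])"

text \<open>
  The itinerary of the interval of \<open>\<gamma>\<close> at time \<open>- i\<close> under the interval exchange at time \<open>- i - j\<close>.
\<close>

primrec words :: "nat \<Rightarrow> nat \<Rightarrow> 'a \<Rightarrow> 'a list" where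
  "words i 0 \<gamma> = [\<gamma>]"
| "words i (Suc j) \<gamma> = concat (map (sub_word (i + j)) (words i j \<gamma>))"

lemma count_sub_word: "real (count_list (sub_word k \<gamma>) \<beta>) = A k $ \<gamma> $ \<beta>"
  using winner_neq_loser[of k] by (auto simp: sub_word_def A_entry)

lemma count_words: "real (count_list (words i j \<gamma>) \<beta>) = M i j $ \<gamma> $ \<beta>"
proof (induction j arbitrary: \<beta>)
  case 0
  then show ?case by (simp add: mat_def)
next
  case (Suc j)
  have "real (count_list (words i (Suc j) \<gamma>) \<beta>)
      = sum_list (map (\<lambda>a. real (count_list (sub_word (i + j) a) \<beta>)) (words i j \<gamma>))"
    by (simp add: count_list_concat_map)
  also have "\<dots> = (\<Sum>a\<in>UNIV. M i j $ \<gamma> $ a * A (i + j) $ a $ \<beta>)"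
    unfolding sum_list_eq_sum_count Suc count_sub_word ..
  also have "\<dots> = M i (Suc j) $ \<gamma> $ \<beta>"
    unfolding M_Suc by (simp add: matrix_matrix_mult_def)
  finally show ?case .
qed

lemma M_nonneg: "0 \<le> M i j $ \<gamma> $ \<beta>"
  by (simp flip: count_words)

text \<open>
  This concatenation rule is what allows a dual sum to be cut at an intermediate time.
\<close>

lemma words_add: "words i (j + j') \<gamma> = concat (map (words (i + j) j') (words i j \<gamma>))"
  by (induction j') (simp_all add: concat_map_concat_map add.assoc)

lemma length_words: "real (length (words i j \<gamma>)) = (\<Sum>\<beta>\<in>UNIV. M i j $ \<gamma> $ \<beta>)"
  unfolding count_words[symmetric] of_nat_sum[symmetric] by (subst sum_count_set) auto

text \<open>
  Laid side by side in the order of the word, the fine intervals fill the coarse one.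
\<close>

lemma sum_q_words: "(\<Sum>\<beta>\<leftarrow>words i j \<gamma>. q (i + j) $ \<beta>) = q i $ \<gamma>"
  unfolding sum_list_eq_sum_count count_words q_M[of i j] by (simp only: matrix_vector_mult_def vec_lambda_beta)

end

fun codes :: "(real \<Rightarrow> real) \<Rightarrow> ('a \<Rightarrow> real set) \<Rightarrow> 'a list \<Rightarrow> real \<Rightarrow> bool" where
  "codes f I [] x = True"
| "codes f I (a # ws) x = (x \<in> I a \<and> codes f I ws (f x))"

lemma codes_append: "codes f I (us @ vs) x \<longleftrightarrow> codes f I us x \<and> codes f I vs ((f ^^ length us) x)"
  by (induction us arbitrary: x) (simp_all add: funpow_swap1)

lemma codes_nth: "codes f I ws x \<Longrightarrow> j < length ws \<Longrightarrow> (f ^^ j) x \<in> I (ws ! j)"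
proof (induction ws arbitrary: x j)
  case (Cons a ws)
  then show ?case by (cases j) (auto simp: funpow_swap1)
qed simp

text \<open>
  Passing to an earlier, larger interval refines itineraries: if the first return map \<open>f\<close> follows the
  letters \<open>ws\<close>, then the original map \<open>f'\<close> follows the words that are substituted for them.
\<close>

lemma codes_substitute:
  assumes "\<And>a x. x \<in> I a \<Longrightarrow> codes f' I' (sub a) x \<and> (f' ^^ length (sub a)) x = f x"
    and "codes f I ws x"
  shows "codes f' I' (concat (map sub ws)) x"
  using assms(2)
proof (induction ws arbitrary: x)
  case (Cons a ws)
  then show ?case using assms(1)[of x a] by (simp add: codes_append)
qed simp

lemma left_add_le:
  assumes "\<And>\<alpha>. lam $ \<alpha> > 0" "r a < r b"
  shows "iet_left r lam a + lam $ a \<le> iet_left r lam b"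
proof -
  have "iet_left r lam a + lam $ a = (\<Sum>\<beta> \<in> insert a {\<beta>. r \<beta> < r a}. lam $ \<beta>)"
    by (simp add: iet_left_def)
  also have "\<dots> \<le> iet_left r lam b"
    unfolding iet_left_def using assms by (intro sum_mono2) (auto intro: less_imp_le)
  finally show ?thesis .
qed

lemma iet_interval_unique:
  assumes "is_row (fst p)" "\<And>\<alpha>. lam $ \<alpha> > 0" "x \<in> iet_interval p lam a" "x \<in> iet_interval p lam b"
  shows "a = b"
proof -
  have "\<not> fst p a < fst p b" "\<not> fst p b < fst p a"
    using left_add_le[of lam "fst p" a b] left_add_le[of lam "fst p" b a] assms
    by (fastforce simp: iet_interval_def)+
  then show ?thesis using row_eq_iff[OF assms(1)] by (metis linorder_neqE_nat)
qed

lemma iet_eq: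
  assumes "is_row (fst p)" "\<And>\<alpha>. lam $ \<alpha> > 0" "x \<in> iet_interval p lam a"
  shows "iet p lam x = x - iet_left (fst p) lam a + iet_left (snd p) lam a"
proof -
  have "(THE \<alpha>. x \<in> iet_interval p lam \<alpha>) = a"
    using iet_interval_unique[OF assms(1,2)] assms(3) by blast
  then show ?thesis using assms(3) by (auto simp: iet_def Let_def)
qed

text \<open>
  Intervals with the lengths \<open>Q\<close> and the letters \<open>ws\<close> are laid side by side from \<open>s\<close> on, and \<open>f\<close> is
  summed over the left ends of those with letter \<open>\<beta>\<close>. The recursive form suits induction along a
  substituted word.
\<close>

fun visit_sum :: "real^'a::finite \<Rightarrow> 'a \<Rightarrow> (real \<Rightarrow> real) \<Rightarrow> real \<Rightarrow> 'a list \<Rightarrow> real" where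
  "visit_sum Q \<beta> f s [] = 0"
| "visit_sum Q \<beta> f s (a # ws) = (if a = \<beta> then f s else 0) + visit_sum Q \<beta> f (s + Q $ a) ws"

lemma visit_sum_eq:
  "visit_sum Q \<beta> f s ws = (\<Sum>j | j < length ws \<and> ws ! j = \<beta>. f (s + (\<Sum>i<j. Q $ (ws ! i))))"
proof -
  have "visit_sum Q \<beta> f s ws = (\<Sum>j<length ws. if ws ! j = \<beta> then f (s + (\<Sum>i<j. Q $ (ws ! i))) else 0)"
  proof (induction ws arbitrary: s)
    case (Cons a ws)
    have "(\<Sum>i<Suc j. Q $ ((a # ws) ! i)) = Q $ a + (\<Sum>i<j. Q $ (ws ! i))" for j
      by (simp add: sum.lessThan_Suc_shift del: sum.lessThan_Suc)
    then show ?case by (simp add: Cons sum.lessThan_Suc_shift add.assoc cong: if_cong del: sum.lessThan_Suc)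
  qed simp
  also have "\<dots> = (\<Sum>j | j < length ws \<and> ws ! j = \<beta>. f (s + (\<Sum>i<j. Q $ (ws ! i))))"
    by (rule sum.mono_neutral_cong_right) auto
  finally show ?thesis .
qed

locale backward_orbit_lengths = backward_orbit p \<tau> for p :: "'a::finite rows" and \<tau> +
  fixes lam :: "real^'a"
  assumes lam_pos: "\<forall>\<alpha>. lam $ \<alpha> > 0"
begin

abbreviation "Lam k \<equiv> lam_at p \<tau> lam (- int k)"
abbreviation "I k \<equiv> iet_interval (R k) (Lam k)"
abbreviation "F k \<equiv> iet (R k) (Lam k)"

lemma Lam_Suc: "Lam (Suc k) = add_entry (win k) (los k) (Lam k)"
proof -
  have n: "nat (- (- int (Suc k))) = Suc k" by simp
  show ?thesis unfolding lam_at_def n by (simp add: prev_vec_eq)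
qed

lemma Lam_pos: "Lam k $ \<alpha> > 0"
proof (induction k arbitrary: \<alpha>)
  case 0
  then show ?case using lam_pos by (simp add: lam_at_def)
next
  case (Suc k)
  then show ?case unfolding Lam_Suc by (simp add: add_entry_def add_pos_pos)
qed

lemma F_eq: "x \<in> I k \<gamma> \<Longrightarrow> F k x = x - iet_left (fst (R k)) (Lam k) \<gamma> + iet_left (snd (R k)) (Lam k) \<gamma>"
  by (rule iet_eq[OF row_fst Lam_pos])

lemma sub_word_codes:
  assumes "x \<in> I k \<gamma>"
  shows "codes (F (Suc k)) (I (Suc k)) (sub_word k \<gamma>) x \<and>
         (F (Suc k) ^^ length (sub_word k \<gamma>)) x = F k x"
proof (cases "\<gamma> = los k")
  case False
  have "Lam (Suc k) $ \<gamma> \<ge> Lam k $ \<gamma>"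
    unfolding Lam_Suc using Lam_pos[of k "los k"] by (simp add: add_entry_def)
  then have "x \<in> I (Suc k) \<gamma>"
    using assms left_step(1)[OF False, of "Lam k"] by (simp add: iet_interval_def Lam_Suc[symmetric] del: of_nat_Suc)
  moreover have "F (Suc k) x = F k x"
    using F_eq[OF assms] F_eq[OF calculation] left_step[OF False, of "Lam k"]
    by (simp add: Lam_Suc[symmetric] del: of_nat_Suc)
  ultimately show ?thesis using False by (simp add: sub_word_def del: of_nat_Suc)
next
  case True
  let ?w = "win k" and ?l = "los k"
  have lam': "Lam (Suc k) $ ?w = Lam k $ ?w + Lam k $ ?l" "Lam (Suc k) $ ?l = Lam k $ ?l"
    using winner_neq_loser[of k] by (simp_all add: Lam_Suc add_entry_def del: of_nat_Suc)
  note lw = left_step[OF winner_neq_loser, of k "Lam k", folded Lam_Suc]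
  note pos = Lam_pos[of k ?w] Lam_pos[of k ?l]
  show ?thesis
  proof (cases rule: left_step_loser[of k "Lam k", folded Lam_Suc, case_names top bottom])
    case top
    have x: "x \<in> I (Suc k) ?l"
      using assms top lam' unfolding True by (simp add: iet_interval_def del: of_nat_Suc)
    note Fx = F_eq[OF x]
    have Fxw: "F (Suc k) x \<in> I (Suc k) ?w"
      using assms top lw lam' pos unfolding True Fx by (simp add: iet_interval_def del: of_nat_Suc)
    have "F (Suc k) (F (Suc k) x) = F k x"
      using F_eq[OF assms] F_eq[OF Fxw] Fx top lw unfolding True by (simp del: of_nat_Suc)
    then show ?thesis using x Fxw top(1) by (simp add: sub_word_def True del: of_nat_Suc)
  next
    case bottom
    have x: "x \<in> I (Suc k) ?w"
      using assms bottom lw lam' pos unfolding True by (simp add: iet_interval_def del: of_nat_Suc)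
    note Fx = F_eq[OF x]
    have Fxl: "F (Suc k) x \<in> I (Suc k) ?l"
      using assms bottom lw lam' pos unfolding True Fx by (simp add: iet_interval_def del: of_nat_Suc)
    have "F (Suc k) (F (Suc k) x) = F k x"
      using F_eq[OF assms] F_eq[OF Fxl] Fx bottom lw unfolding True by (simp del: of_nat_Suc)
    then show ?thesis using x Fxl bottom(1) by (simp add: sub_word_def True del: of_nat_Suc)
  qed
qed

lemma words_code: "x \<in> I 0 \<alpha> \<Longrightarrow> codes (F k) (I k) (words 0 k \<alpha>) x"
proof (induction k)
  case (Suc k)
  have "codes (F (Suc k)) (I (Suc k)) (concat (map (sub_word k) (words 0 k \<alpha>))) x"
    by (rule codes_substitute[OF sub_word_codes]) (use Suc in auto)
  then show ?case by (simp del: of_nat_Suc)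
qed simp

lemma visited_eq:
  assumes "j < length (words 0 k \<alpha>)"
  shows "visited p \<tau> lam (- int k) 0 \<alpha> j = words 0 k \<alpha> ! j"
proof -
  have sub: "(F k ^^ j) ` I 0 \<alpha> \<subseteq> I k (words 0 k \<alpha> ! j)"
    using codes_nth[OF words_code assms] by blast
  obtain x where x: "x \<in> I 0 \<alpha>"
    using Lam_pos[of 0 \<alpha>] dense[of "iet_left (fst (R 0)) (Lam 0) \<alpha>" "iet_left (fst (R 0)) (Lam 0) \<alpha> + Lam 0 $ \<alpha>"]
    by (auto simp: iet_interval_def)
  have "\<beta> = words 0 k \<alpha> ! j" if "(F k ^^ j) ` I 0 \<alpha> \<subseteq> I k \<beta>" for \<beta>
    using iet_interval_unique[OF row_fst[of k] Lam_pos[of k]] sub that x by blast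
  note uniq = this[unfolded of_nat_0 minus_zero]
  show ?thesis
    unfolding visited_def by (rule the_equality, rule sub[unfolded of_nat_0 minus_zero], rule uniq)
qed

lemma S_sharp_eq:
  "S_sharp p \<tau> lam 0 (- int k) \<psi> \<beta> x = (\<Sum>\<alpha>\<in>UNIV. visit_sum (q k) \<beta> (\<psi> \<alpha>) x (words 0 k \<alpha>))"
proof -
  have B: "B_row p \<tau> (- int k) 0 \<alpha> = real (length (words 0 k \<alpha>))" for \<alpha>
    unfolding B_row_def Bmat_def length_words by simp
  have "{j. real j < B_row p \<tau> (- int k) 0 \<alpha> \<and> visited p \<tau> lam (- int k) 0 \<alpha> j = \<beta>}
      = {j. j < length (words 0 k \<alpha>) \<and> words 0 k \<alpha> ! j = \<beta>}" for \<alpha>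
    unfolding B of_nat_less_iff by (rule Collect_cong) (metis visited_eq)
  moreover have "Sq p \<tau> lam (- int k) 0 \<alpha> j = (\<Sum>i<j. q k $ (words 0 k \<alpha> ! i))"
    if "j < length (words 0 k \<alpha>)" for \<alpha> j
    unfolding Sq_def by (intro sum.cong) (use that visited_eq in auto)
  ultimately show ?thesis
    unfolding S_sharp_def visit_sum_eq by (intro sum.cong) auto
qed

end


section \<open>Replacing a function by its means over coarse tiles\<close>

lemma visit_sum_append:
  "visit_sum Q \<beta> f s (us @ vs) = visit_sum Q \<beta> f s us + visit_sum Q \<beta> f (s + (\<Sum>a\<leftarrow>us. Q $ a)) vs"
  by (induction us arbitrary: s) (simp_all add: add.assoc)

lemma visit_sum_diff_const:
  "visit_sum Q \<beta> (\<lambda>t. f t - c) s ws = visit_sum Q \<beta> f s ws - c * real (count_list ws \<beta>)"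
  by (induction ws arbitrary: s) (simp_all add: algebra_simps)

lemma sum_list_entries_nonneg: "(\<And>a. (Q :: real^'a::finite) $ a \<ge> 0) \<Longrightarrow> 0 \<le> (\<Sum>a\<leftarrow>ws. Q $ a)"
  by (induction ws) simp_all

lemma visit_sum_bound:
  assumes "\<And>a. Q $ a \<ge> 0"
    and "\<And>t. s \<le> t \<Longrightarrow> t + Q $ \<beta> \<le> s + (\<Sum>a\<leftarrow>ws. Q $ a) \<Longrightarrow> \<bar>f t\<bar> \<le> E"
  shows "\<bar>visit_sum Q \<beta> f s ws\<bar> \<le> E * real (count_list ws \<beta>)"
  using assms(2)
proof (induction ws arbitrary: s)
  case (Cons a ws)
  have "\<bar>f s\<bar> \<le> E" if "a = \<beta>"
    using Cons.prems[of s] sum_list_entries_nonneg[OF assms(1), of ws] that by simp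
  moreover have "\<bar>visit_sum Q \<beta> f (s + Q $ a) ws\<bar> \<le> E * real (count_list ws \<beta>)"
  proof (rule Cons.IH)
    fix t assume "s + Q $ a \<le> t" "t + Q $ \<beta> \<le> s + Q $ a + (\<Sum>a\<leftarrow>ws. Q $ a)"
    then show "\<bar>f t\<bar> \<le> E" using assms(1)[of a] by (intro Cons.prems) auto
  qed
  ultimately show ?case by (auto simp: algebra_simps)
qed simp

definition interval_mean :: "(real \<Rightarrow> real) \<Rightarrow> real \<Rightarrow> real \<Rightarrow> real" where
  "interval_mean f c s = integral {s..s + c} f / c"

lemma interval_mean_close:
  assumes "c > 0" "f integrable_on {s..s + c}" "\<And>z. s < z \<Longrightarrow> z < s + c \<Longrightarrow> \<bar>f z - y\<bar> \<le> E"
  shows "\<bar>interval_mean f c s - y\<bar> \<le> E"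
proof -
  let ?S = "{s<..<s + c}"
  have int: "f integrable_on ?S" "(\<lambda>z. y) integrable_on ?S" "(\<lambda>z. E) integrable_on ?S"
    using assms(2) by (simp_all add: integrable_on_open_interval_real integrable_const_ivl)
  have const: "integral ?S (\<lambda>z. u) = c * u" for u :: real
    unfolding integral_open_interval_real[symmetric] using assms(1) by simp
  have "norm (integral ?S (\<lambda>z. f z - y)) \<le> integral ?S (\<lambda>z. E)"
    using assms(3) int by (intro integral_norm_bound_integral integrable_diff) auto
  then have "\<bar>integral {s..s + c} f - c * y\<bar> \<le> c * E"
    using int by (simp add: integral_diff const integral_open_interval_real[of s "s + c" f])
  moreover have "integral {s..s + c} f - c * y = c * (interval_mean f c s - y)"
    using assms(1) by (simp add: interval_mean_def field_simps)
  ultimately show ?thesis using assms(1) by (simp add: abs_mult)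
qed

text \<open>
  The fine visits to \<open>\<beta>\<close> that fall in a coarse tile of type \<open>\<gamma>\<close> starting at \<open>t\<close> are as many as the
  occurrences of \<open>\<beta>\<close> in \<open>V \<gamma>\<close>; in each of them the value of \<open>f\<close> is replaced by the constant \<open>g \<gamma> t\<close>
  attached to the tile.
\<close>

lemma visit_sum_coarsen:
  fixes Qc Qf :: "real^'a::finite" and V :: "'a \<Rightarrow> 'a list"
  assumes fine: "\<And>\<gamma>. (\<Sum>b\<leftarrow>V \<gamma>. Qf $ b) = Qc $ \<gamma>" and pos: "\<And>b. Qf $ b > 0" "\<And>b. Qc $ b \<ge> 0"
    and x: "0 < x" "x < Qf $ \<beta>"
    and close: "\<And>\<gamma> t y. s \<le> t \<Longrightarrow> t + Qc $ \<gamma> \<le> s + (\<Sum>a\<leftarrow>us. Qc $ a) \<Longrightarrow> t < y \<Longrightarrow> y < t + Qc $ \<gamma>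
        \<Longrightarrow> \<bar>f y - g \<gamma> t\<bar> \<le> E"
  shows "\<bar>visit_sum Qf \<beta> f (s + x) (concat (map V us))
           - (\<Sum>\<gamma>\<in>UNIV. real (count_list (V \<gamma>) \<beta>) * visit_sum Qc \<gamma> (g \<gamma>) s us)\<bar>
         \<le> E * real (count_list (concat (map V us)) \<beta>)"
  using close
proof (induction us arbitrary: s)
  case (Cons a us)
  let ?tot = "\<Sum>b\<leftarrow>us. Qc $ b" and ?n = "\<lambda>\<gamma>. real (count_list (V \<gamma>) \<beta>)"
  have tot: "0 \<le> ?tot" by (rule sum_list_entries_nonneg[OF pos(2)])
  have "\<bar>visit_sum Qf \<beta> (\<lambda>t. f t - g a s) (s + x) (V a)\<bar> \<le> E * ?n a"
  proof (rule visit_sum_bound)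
    fix t assume "s + x \<le> t" "t + Qf $ \<beta> \<le> s + x + (\<Sum>b\<leftarrow>V a. Qf $ b)"
    then show "\<bar>f t - g a s\<bar> \<le> E" using fine x tot by (intro Cons.prems) auto
  qed (use pos in \<open>auto intro: less_imp_le\<close>)
  then have 1: "\<bar>visit_sum Qf \<beta> f (s + x) (V a) - g a s * ?n a\<bar> \<le> E * ?n a"
    unfolding visit_sum_diff_const .
  have 2: "\<bar>visit_sum Qf \<beta> f (s + Qc $ a + x) (concat (map V us))
      - (\<Sum>\<gamma>\<in>UNIV. ?n \<gamma> * visit_sum Qc \<gamma> (g \<gamma>) (s + Qc $ a) us)\<bar>
      \<le> E * real (count_list (concat (map V us)) \<beta>)"
  proof (rule Cons.IH)
    fix \<gamma> t y
    assume "s + Qc $ a \<le> t" "t + Qc $ \<gamma> \<le> s + Qc $ a + ?tot" "t < y" "y < t + Qc $ \<gamma>"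
    then show "\<bar>f y - g \<gamma> t\<bar> \<le> E" using pos(2)[of a] by (intro Cons.prems) auto
  qed
  have 3: "(\<Sum>\<gamma>\<in>UNIV. ?n \<gamma> * visit_sum Qc \<gamma> (g \<gamma>) s (a # us))
      = g a s * ?n a + (\<Sum>\<gamma>\<in>UNIV. ?n \<gamma> * visit_sum Qc \<gamma> (g \<gamma>) (s + Qc $ a) us)"
  proof -
    have "(\<Sum>\<gamma>\<in>UNIV. ?n \<gamma> * visit_sum Qc \<gamma> (g \<gamma>) s (a # us))
        = (\<Sum>\<gamma>\<in>UNIV. (if \<gamma> = a then g a s * ?n a else 0) + ?n \<gamma> * visit_sum Qc \<gamma> (g \<gamma>) (s + Qc $ a) us)"
      by (intro sum.cong) (auto simp: algebra_simps)
    then show ?thesis by (simp add: sum.distrib)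
  qed
  have 4: "visit_sum Qf \<beta> f (s + x) (concat (map V (a # us)))
      = visit_sum Qf \<beta> f (s + x) (V a) + visit_sum Qf \<beta> f (s + Qc $ a + x) (concat (map V us))"
    using fine[of a] by (simp add: visit_sum_append algebra_simps)
  have 5: "E * real (count_list (concat (map V (a # us))) \<beta>)
      = E * ?n a + E * real (count_list (concat (map V us)) \<beta>)"
    by (simp add: algebra_simps)
  show ?case using 1 2 unfolding 3 4 5 by linarith
qed simp

lemma visit_sum_means:
  assumes "\<And>a. Q $ a > 0" "f integrable_on {s..s + (\<Sum>a\<leftarrow>us. Q $ a)}"
  shows "(\<Sum>\<gamma>\<in>UNIV. Q $ \<gamma> * visit_sum Q \<gamma> (interval_mean f (Q $ \<gamma>)) s us)
         = integral {s..s + (\<Sum>a\<leftarrow>us. Q $ a)} f"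
  using assms(2)
proof (induction us arbitrary: s)
  case (Cons a us)
  let ?tot = "\<Sum>b\<leftarrow>us. Q $ b"
  have tot: "0 \<le> ?tot" by (rule sum_list_entries_nonneg[OF less_imp_le[OF assms(1)]])
  have int: "f integrable_on {s..s + Q $ a + ?tot}" using Cons.prems by (simp add: add.assoc)
  then have "f integrable_on {s + Q $ a..s + Q $ a + ?tot}"
    by (rule integrable_on_subinterval) (use assms(1)[of a] in auto)
  note IH = Cons.IH[OF this]
  have "(\<Sum>\<gamma>\<in>UNIV. Q $ \<gamma> * visit_sum Q \<gamma> (interval_mean f (Q $ \<gamma>)) s (a # us))
      = (\<Sum>\<gamma>\<in>UNIV. (if \<gamma> = a then Q $ a * interval_mean f (Q $ a) s else 0)
          + Q $ \<gamma> * visit_sum Q \<gamma> (interval_mean f (Q $ \<gamma>)) (s + Q $ a) us)"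
    by (intro sum.cong) (auto simp: algebra_simps)
  also have "\<dots> = Q $ a * interval_mean f (Q $ a) s + integral {s + Q $ a..s + Q $ a + ?tot} f"
    unfolding sum.distrib IH by simp
  also have "Q $ a * interval_mean f (Q $ a) s = integral {s..s + Q $ a} f"
    using assms(1)[of a] by (simp add: interval_mean_def)
  also have "\<dots> + integral {s + Q $ a..s + Q $ a + ?tot} f = integral {s..s + Q $ a + ?tot} f"
    by (rule Henstock_Kurzweil_Integration.integral_combine[OF _ _ int]) (use tot assms(1)[of a] in auto)
  finally show ?case by (simp add: add.assoc)
qed simp

lemma holder_bounded:
  fixes f :: "real \<Rightarrow> real"
  assumes "b > 0" "0 < \<eta>"
    and K: "\<And>x y. x \<in> {0<..<b} \<Longrightarrow> y \<in> {0<..<b} \<Longrightarrow> \<bar>f x - f y\<bar> \<le> K * \<bar>x - y\<bar> powr \<eta>"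
    and x: "x \<in> {0<..<b}"
  shows "\<bar>f x\<bar> \<le> \<bar>f (b / 2)\<bar> + \<bar>K\<bar> * b powr \<eta>"
proof -
  have "\<bar>f x - f (b / 2)\<bar> \<le> K * \<bar>x - b / 2\<bar> powr \<eta>" using K[OF x, of "b / 2"] assms(1) by simp
  also have "\<dots> \<le> \<bar>K\<bar> * b powr \<eta>"
    using x assms(2) by (intro mult_mono powr_mono2) auto
  finally show ?thesis by linarith
qed

text \<open>
  The function is only controlled on the open interval, where it is continuous and bounded; the values
  at the end points do not affect integrability.
\<close>

lemma holder_integrable:
  fixes f :: "real \<Rightarrow> real"
  assumes "b > 0" "0 < \<eta>"
    and K: "\<And>x y. x \<in> {0<..<b} \<Longrightarrow> y \<in> {0<..<b} \<Longrightarrow> \<bar>f x - f y\<bar> \<le> K * \<bar>x - y\<bar> powr \<eta>"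
  shows "f integrable_on {0..b}"
proof -
  have "continuous_on {0<..<b} f"
  proof (unfold continuous_on_def, intro ballI)
    fix y assume y: "y \<in> {0<..<b}"
    have "((\<lambda>x. \<bar>x - y\<bar> powr \<eta>) \<longlongrightarrow> 0) (at y within {0<..<b})"
    proof (rule tendsto_zero_powrI[OF _ tendsto_const _ assms(2)])
      show "((\<lambda>x. \<bar>x - y\<bar>) \<longlongrightarrow> 0) (at y within {0<..<b})"
        by (rule tendsto_eq_intros refl | simp)+
    qed simp
    then have "((\<lambda>x. K * \<bar>x - y\<bar> powr \<eta>) \<longlongrightarrow> 0) (at y within {0<..<b})"
      using tendsto_mult_right_zero by blast
    moreover have "\<forall>\<^sub>F x in at y within {0<..<b}. norm (f x - f y) \<le> K * \<bar>x - y\<bar> powr \<eta>"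
      unfolding eventually_at_filter using K[OF _ y] by (auto intro: always_eventually)
    ultimately have "((\<lambda>x. f x - f y) \<longlongrightarrow> 0) (at y within {0<..<b})"
      by (rule Lim_null_comparison[rotated])
    then show "(f \<longlongrightarrow> f y) (at y within {0<..<b})" by (simp add: LIM_zero_iff)
  qed
  then have "f \<in> borel_measurable (lebesgue_on {0<..<b})"
    by (rule continuous_imp_measurable_on_sets_lebesgue) simp
  then have "f integrable_on {0<..<b}"
  proof (rule measurable_bounded_by_integrable_imp_integrable)
    show "(\<lambda>x. \<bar>f (b / 2)\<bar> + \<bar>K\<bar> * b powr \<eta>) integrable_on {0<..<b}"
      unfolding integrable_on_open_interval_real by (rule integrable_const_ivl)
    show "norm (f x) \<le> \<bar>f (b / 2)\<bar> + \<bar>K\<bar> * b powr \<eta>" if "x \<in> {0<..<b}" for x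
      using holder_bounded[OF assms that] by simp
  qed simp
  then show ?thesis by (simp add: integrable_on_open_interval_real)
qed

lemma holder_norm_bounds:
  fixes b :: "'a::finite \<Rightarrow> real"
  defines "D \<equiv> \<lambda>\<alpha>. {0<..<b \<alpha>}"
  assumes b: "\<And>\<alpha>. b \<alpha> > 0" and \<eta>: "0 < \<eta>" and \<psi>: "holder_on D \<eta> \<psi>"
  shows "x \<in> D \<alpha> \<Longrightarrow> \<bar>\<psi> \<alpha> x\<bar> \<le> C0_norm D \<psi>"
    and "x \<in> D \<alpha> \<Longrightarrow> y \<in> D \<alpha> \<Longrightarrow> \<bar>\<psi> \<alpha> x - \<psi> \<alpha> y\<bar> \<le> holder_seminorm D \<eta> \<psi> * \<bar>x - y\<bar> powr \<eta>"
    and "0 \<le> C0_norm D \<psi>" and "0 \<le> holder_seminorm D \<eta> \<psi>"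
proof -
  obtain K where K: "\<And>\<alpha> x y. x \<in> D \<alpha> \<Longrightarrow> y \<in> D \<alpha> \<Longrightarrow> \<bar>\<psi> \<alpha> x - \<psi> \<alpha> y\<bar> \<le> K \<alpha> * \<bar>x - y\<bar> powr \<eta>"
    using \<psi> unfolding holder_on_def by metis
  let ?X = "{\<bar>\<psi> \<alpha> x\<bar> | \<alpha> x. x \<in> D \<alpha>}"
  let ?Y = "{\<bar>\<psi> \<alpha> x - \<psi> \<alpha> y\<bar> / \<bar>x - y\<bar> powr \<eta> | \<alpha> x y. x \<in> D \<alpha> \<and> y \<in> D \<alpha> \<and> x \<noteq> y}"
  let ?c = "\<lambda>\<alpha>. \<bar>\<psi> \<alpha> (b \<alpha> / 2)\<bar> + \<bar>K \<alpha>\<bar> * b \<alpha> powr \<eta>"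
  have "bdd_above ?X"
  proof (rule bdd_aboveI)
    fix z assume "z \<in> ?X"
    then obtain \<alpha> x where x: "z = \<bar>\<psi> \<alpha> x\<bar>" "x \<in> D \<alpha>" by blast
    have "z \<le> ?c \<alpha>"
      unfolding x(1) by (rule holder_bounded[OF b \<eta>]) (use x(2) K in \<open>auto simp: D_def\<close>)
    also have "\<dots> \<le> (\<Sum>\<alpha>\<in>UNIV. ?c \<alpha>)" by (rule member_le_sum) auto
    finally show "z \<le> (\<Sum>\<alpha>\<in>UNIV. ?c \<alpha>)" .
  qed
  note X = cSup_upper[OF _ this]
  show 1: "x \<in> D \<alpha> \<Longrightarrow> \<bar>\<psi> \<alpha> x\<bar> \<le> C0_norm D \<psi>" for x \<alpha>
    unfolding C0_norm_def by (rule X) blast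
  have "bdd_above ?Y"
  proof (rule bdd_aboveI)
    fix z assume "z \<in> ?Y"
    then obtain \<alpha> x y where x: "z = \<bar>\<psi> \<alpha> x - \<psi> \<alpha> y\<bar> / \<bar>x - y\<bar> powr \<eta>" "x \<in> D \<alpha>" "y \<in> D \<alpha>" "x \<noteq> y"
      by blast
    have "z \<le> K \<alpha>" unfolding x(1) using K[OF x(2,3)] x(4) by (simp add: divide_le_eq)
    also have "\<dots> \<le> \<bar>K \<alpha>\<bar>" by simp
    also have "\<dots> \<le> (\<Sum>\<alpha>\<in>UNIV. \<bar>K \<alpha>\<bar>)" by (rule member_le_sum) auto
    finally show "z \<le> (\<Sum>\<alpha>\<in>UNIV. \<bar>K \<alpha>\<bar>)" .
  qed
  note Y = cSup_upper[OF _ this]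
  have Y': "\<bar>\<psi> \<alpha> x - \<psi> \<alpha> y\<bar> / \<bar>x - y\<bar> powr \<eta> \<le> holder_seminorm D \<eta> \<psi>"
    if "x \<in> D \<alpha>" "y \<in> D \<alpha>" "x \<noteq> y" for x y \<alpha>
    unfolding holder_seminorm_def by (rule Y) (use that in blast)
  show "x \<in> D \<alpha> \<Longrightarrow> y \<in> D \<alpha> \<Longrightarrow> \<bar>\<psi> \<alpha> x - \<psi> \<alpha> y\<bar> \<le> holder_seminorm D \<eta> \<psi> * \<bar>x - y\<bar> powr \<eta>" for x y \<alpha>
    using Y'[of x \<alpha> y] by (cases "x = y") (simp_all add: divide_le_eq)
  have mem: "b \<alpha> / 2 \<in> D \<alpha>" "b \<alpha> / 3 \<in> D \<alpha>" "b \<alpha> / 2 \<noteq> b \<alpha> / 3" for \<alpha>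
    using b[of \<alpha>] by (auto simp: D_def)
  show "0 \<le> C0_norm D \<psi>" using 1[OF mem(1)] abs_ge_zero order_trans by blast
  show "0 \<le> holder_seminorm D \<eta> \<psi>"
    by (rule order_trans[OF _ Y'[OF mem]]) simp
qed

lemma mat_norm_nonneg: "0 \<le> mat_norm B"
  by (simp add: mat_norm_def sum_nonneg)

lemma column_le_mat_norm: "(\<Sum>\<alpha>\<in>UNIV. \<bar>B $ \<alpha> $ \<beta>\<bar>) \<le> mat_norm B"
  unfolding mat_norm_def by (intro sum_mono member_le_sum) auto

context backward_orbit_lengths
begin

text \<open>
  The vector \<open>c\<close> collects, for each letter \<open>\<gamma>\<close>, the means of \<open>\<psi>\<close> over the tiles of type \<open>\<gamma>\<close> at time
  \<open>- i\<close>. Weighted with the lengths \<open>q i\<close> the means add up to the integral of \<open>\<psi>\<close>, which gives the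
  orthogonality; a tile of type \<open>\<gamma>\<close> contains \<open>M i j $ \<gamma> $ \<beta>\<close> fine tiles of type \<open>\<beta>\<close>, which gives the
  transposed matrix.
\<close>

lemma dual_sum_decomposition:
  assumes \<psi>: "holder_on (L p \<tau> 0) \<eta> \<psi>" "mean_zero (L p \<tau> 0) \<psi>" and \<eta>: "0 < \<eta>"
    and m: "\<And>\<gamma>. q i $ \<gamma> \<le> m"
  obtains c where "(\<Sum>\<gamma>\<in>UNIV. q i $ \<gamma> * c $ \<gamma>) = 0"
    and "\<And>\<gamma>. \<bar>c $ \<gamma>\<bar> \<le> C0_norm (L p \<tau> 0) \<psi> * mat_norm (M 0 i)"
    and "\<And>\<beta> x. x \<in> L p \<tau> (- int (i + j)) \<beta> \<Longrightarrow>
           \<bar>S_sharp p \<tau> lam 0 (- int (i + j)) \<psi> \<beta> x - (transpose (M i j) *v c) $ \<beta>\<bar>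
             \<le> holder_seminorm (L p \<tau> 0) \<eta> \<psi> * m powr \<eta> * mat_norm (M 0 (i + j))"
proof
  let ?N = "C0_norm (L p \<tau> 0) \<psi>" and ?H = "holder_seminorm (L p \<tau> 0) \<eta> \<psi>"
  define g where "g \<alpha> \<gamma> = interval_mean (\<psi> \<alpha>) (q i $ \<gamma>)" for \<alpha> \<gamma>
  define c where "c = (\<chi> \<gamma>. \<Sum>\<alpha>\<in>UNIV. visit_sum (q i) \<gamma> (g \<alpha> \<gamma>) 0 (words 0 i \<alpha>))"
  have L0: "L p \<tau> 0 = (\<lambda>\<alpha>. {0<..<q 0 $ \<alpha>})" by (auto simp: L_def)
  note bnd = holder_norm_bounds[of "\<lambda>\<alpha>. q 0 $ \<alpha>", OF q_pos \<eta> \<psi>(1)[unfolded L0], folded L0]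
  have tot: "(\<Sum>a\<leftarrow>words 0 i \<alpha>. q i $ a) = q 0 $ \<alpha>" for \<alpha>
    using sum_q_words[of 0 i \<alpha>] by simp
  have intg: "\<psi> \<alpha> integrable_on {0..q 0 $ \<alpha>}" for \<alpha>
    by (rule holder_integrable[OF q_pos \<eta> bnd(2)[unfolded L0]])
  have sub: "\<psi> \<alpha> integrable_on {t..t + q i $ \<gamma>}" if "0 \<le> t" "t + q i $ \<gamma> \<le> q 0 $ \<alpha>" for t \<alpha> \<gamma>
    by (rule integrable_on_subinterval[OF intg]) (use that in auto)
  have "(\<Sum>\<gamma>\<in>UNIV. q i $ \<gamma> * c $ \<gamma>)
      = (\<Sum>\<alpha>\<in>UNIV. \<Sum>\<gamma>\<in>UNIV. q i $ \<gamma> * visit_sum (q i) \<gamma> (g \<alpha> \<gamma>) 0 (words 0 i \<alpha>))"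
    unfolding c_def by (simp add: sum_distrib_left, rule sum.swap)
  also have "\<dots> = (\<Sum>\<alpha>\<in>UNIV. integral {0..q 0 $ \<alpha>} (\<psi> \<alpha>))"
    unfolding g_def using intg q_pos[of i]
    by (intro sum.cong refl) (subst visit_sum_means, simp_all only: tot add_0)
  also have "\<dots> = 0"
    using \<psi>(2) by (simp add: mean_zero_def L0 integral_open_interval_real)
  finally show "(\<Sum>\<gamma>\<in>UNIV. q i $ \<gamma> * c $ \<gamma>) = 0" .
  show "\<bar>c $ \<gamma>\<bar> \<le> ?N * mat_norm (M 0 i)" for \<gamma>
  proof -
    have "\<bar>c $ \<gamma>\<bar> \<le> (\<Sum>\<alpha>\<in>UNIV. \<bar>visit_sum (q i) \<gamma> (g \<alpha> \<gamma>) 0 (words 0 i \<alpha>)\<bar>)"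
      unfolding c_def by simp
    also have "\<dots> \<le> (\<Sum>\<alpha>\<in>UNIV. ?N * real (count_list (words 0 i \<alpha>) \<gamma>))"
    proof (intro sum_mono visit_sum_bound)
      fix \<alpha> t assume t: "0 \<le> t" "t + q i $ \<gamma> \<le> 0 + (\<Sum>a\<leftarrow>words 0 i \<alpha>. q i $ a)"
      have "\<bar>g \<alpha> \<gamma> t - 0\<bar> \<le> ?N"
        unfolding g_def
        by (rule interval_mean_close[OF q_pos sub]) (use t bnd(1)[of _ \<alpha>] in \<open>auto simp: tot L0\<close>)
      then show "\<bar>g \<alpha> \<gamma> t\<bar> \<le> ?N" by simp
    qed (use q_pos[of i] in \<open>auto intro: less_imp_le\<close>)
    also have "\<dots> = ?N * (\<Sum>\<alpha>\<in>UNIV. \<bar>M 0 i $ \<alpha> $ \<gamma>\<bar>)"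
      by (simp only: sum_distrib_left count_words abs_of_nonneg[OF M_nonneg])
    also have "\<dots> \<le> ?N * mat_norm (M 0 i)"
      using bnd(3) column_le_mat_norm by (intro mult_left_mono)
    finally show ?thesis .
  qed
  show "\<bar>S_sharp p \<tau> lam 0 (- int (i + j)) \<psi> \<beta> x - (transpose (M i j) *v c) $ \<beta>\<bar>
          \<le> ?H * m powr \<eta> * mat_norm (M 0 (i + j))" if x: "x \<in> L p \<tau> (- int (i + j)) \<beta>" for \<beta> x
  proof -
    let ?V = "\<lambda>\<alpha>. visit_sum (q (i + j)) \<beta> (\<psi> \<alpha>) (0 + x) (concat (map (words i j) (words 0 i \<alpha>)))"
    let ?W = "\<lambda>\<alpha>. \<Sum>\<gamma>\<in>UNIV. real (count_list (words i j \<gamma>) \<beta>) * visit_sum (q i) \<gamma> (g \<alpha> \<gamma>) 0 (words 0 i \<alpha>)"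
    have words: "concat (map (words i j) (words 0 i \<alpha>)) = words 0 (i + j) \<alpha>" for \<alpha>
      using words_add[of 0 i j \<alpha>] by simp
    have "(transpose (M i j) *v c) $ \<beta> = (\<Sum>\<gamma>\<in>UNIV. \<Sum>\<alpha>\<in>UNIV.
        real (count_list (words i j \<gamma>) \<beta>) * visit_sum (q i) \<gamma> (g \<alpha> \<gamma>) 0 (words 0 i \<alpha>))"
      unfolding c_def by (simp add: matrix_vector_mult_def transpose_def count_words sum_distrib_left)
    also have "\<dots> = (\<Sum>\<alpha>\<in>UNIV. ?W \<alpha>)" by (rule sum.swap)
    finally have main: "(transpose (M i j) *v c) $ \<beta> = (\<Sum>\<alpha>\<in>UNIV. ?W \<alpha>)" .
    have S: "S_sharp p \<tau> lam 0 (- int (i + j)) \<psi> \<beta> x = (\<Sum>\<alpha>\<in>UNIV. ?V \<alpha>)"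
      unfolding S_sharp_eq words by simp
    have "\<bar>?V \<alpha> - ?W \<alpha>\<bar> \<le> ?H * m powr \<eta> * real (count_list (concat (map (words i j) (words 0 i \<alpha>))) \<beta>)" for \<alpha>
    proof (rule visit_sum_coarsen[OF sum_q_words q_pos less_imp_le[OF q_pos]])
      show "0 < x" "x < q (i + j) $ \<beta>" using x by (auto simp: L_def)
      fix \<gamma> t y
      assume t: "0 \<le> t" "t + q i $ \<gamma> \<le> 0 + (\<Sum>a\<leftarrow>words 0 i \<alpha>. q i $ a)" "t < y" "y < t + q i $ \<gamma>"
      have "\<bar>g \<alpha> \<gamma> t - \<psi> \<alpha> y\<bar> \<le> ?H * m powr \<eta>"
        unfolding g_def
      proof (rule interval_mean_close[OF q_pos sub])
        fix z assume z: "t < z" "z < t + q i $ \<gamma>"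
        have "\<bar>\<psi> \<alpha> z - \<psi> \<alpha> y\<bar> \<le> ?H * \<bar>z - y\<bar> powr \<eta>"
          by (rule bnd(2)) (use t z in \<open>auto simp: L0 tot\<close>)
        also have "\<dots> \<le> ?H * m powr \<eta>"
          using bnd(4) \<eta> t z m[of \<gamma>] by (intro mult_left_mono powr_mono2) auto
        finally show "\<bar>\<psi> \<alpha> z - \<psi> \<alpha> y\<bar> \<le> ?H * m powr \<eta>" .
      qed (use t tot in auto)
      then show "\<bar>\<psi> \<alpha> y - g \<alpha> \<gamma> t\<bar> \<le> ?H * m powr \<eta>" by (simp add: abs_minus_commute)
    qed
    then have "(\<Sum>\<alpha>\<in>UNIV. \<bar>?V \<alpha> - ?W \<alpha>\<bar>)
        \<le> (\<Sum>\<alpha>\<in>UNIV. ?H * m powr \<eta> * \<bar>M 0 (i + j) $ \<alpha> $ \<beta>\<bar>)"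
      unfolding words count_words abs_of_nonneg[OF M_nonneg] by (rule sum_mono)
    also have "\<dots> \<le> ?H * m powr \<eta> * mat_norm (M 0 (i + j))"
      unfolding sum_distrib_left[symmetric] using bnd(4) column_le_mat_norm by (intro mult_left_mono) auto
    finally show ?thesis
      unfolding S main sum_subtractf[symmetric] by (rule order_trans[OF sum_abs])
  qed
qed

end


section \<open>Bounds on the cocycle\<close>

lemma norm_matrix_mult_le:
  fixes B :: "real^'a::finite^'a"
  shows "norm (B *v v) \<le> mat_norm B * norm v"
proof -
  have "norm (B *v v) \<le> (\<Sum>\<alpha>\<in>UNIV. \<bar>\<Sum>\<beta>\<in>UNIV. B $ \<alpha> $ \<beta> * v $ \<beta>\<bar>)"
    by (rule order_trans[OF norm_le_l1_cart]) (simp add: matrix_vector_mult_def)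
  also have "\<dots> \<le> (\<Sum>\<alpha>\<in>UNIV. \<Sum>\<beta>\<in>UNIV. \<bar>B $ \<alpha> $ \<beta>\<bar> * norm v)"
    by (intro sum_mono order_trans[OF sum_abs]) (auto simp: abs_mult intro!: mult_left_mono component_le_norm_cart)
  also have "\<dots> = mat_norm B * norm v" by (simp add: mat_norm_def sum_distrib_right)
  finally show ?thesis .
qed

lemma mat_norm_transpose: "mat_norm (transpose B) = mat_norm B"
  unfolding mat_norm_def transpose_def by (simp, rule sum.swap)

lemma mat_norm_mult: "mat_norm (B ** B') \<le> mat_norm B * mat_norm B'"
proof -
  have "mat_norm (B ** B') \<le> (\<Sum>\<alpha>\<in>UNIV. \<Sum>\<beta>\<in>UNIV. \<Sum>\<gamma>\<in>UNIV. \<bar>B $ \<alpha> $ \<gamma>\<bar> * \<bar>B' $ \<gamma> $ \<beta>\<bar>)"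
    unfolding mat_norm_def matrix_matrix_mult_def
    by (intro sum_mono) (simp add: abs_mult[symmetric])
  also have "\<dots> = (\<Sum>\<alpha>\<in>UNIV. \<Sum>\<gamma>\<in>UNIV. \<bar>B $ \<alpha> $ \<gamma>\<bar> * (\<Sum>\<beta>\<in>UNIV. \<bar>B' $ \<gamma> $ \<beta>\<bar>))"
    unfolding sum_distrib_left by (intro sum.cong refl sum.swap)
  also have "\<dots> \<le> (\<Sum>\<alpha>\<in>UNIV. \<Sum>\<gamma>\<in>UNIV. \<bar>B $ \<alpha> $ \<gamma>\<bar> * mat_norm B')"
    unfolding mat_norm_def
    by (intro sum_mono mult_left_mono member_le_sum[of _ _ "\<lambda>\<gamma>. \<Sum>\<beta>\<in>UNIV. \<bar>B' $ \<gamma> $ \<beta>\<bar>"]) (auto intro: sum_nonneg)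
  also have "\<dots> = mat_norm B * mat_norm B'" by (simp add: mat_norm_def sum_distrib_right)
  finally show ?thesis .
qed

lemma restricted_norm_le:
  assumes H: "\<And>r v. v \<in> H \<Longrightarrow> r *\<^sub>R v \<in> H" and v: "v \<in> H"
  shows "norm (B *v v) \<le> restricted_norm B H * norm v"
proof (cases "v = 0")
  case False
  let ?u = "inverse (norm v) *\<^sub>R v"
  have "bdd_above ((\<lambda>v. norm (B *v v)) ` {v \<in> H. norm v \<le> 1})"
  proof (rule bdd_aboveI2)
    fix u assume "u \<in> {v \<in> H. norm v \<le> 1}"
    then show "norm (B *v u) \<le> mat_norm B"
      using norm_matrix_mult_le[of B u] mult_left_mono[of "norm u" 1 "mat_norm B"] mat_norm_nonneg[of B] by auto
  qed
  moreover have "?u \<in> {v \<in> H. norm v \<le> 1}" using H[OF v] False by simp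
  ultimately have "norm (B *v ?u) \<le> restricted_norm B H"
    unfolding restricted_norm_def by (rule cSUP_upper[rotated])
  moreover have "B *v ?u = inverse (norm v) *\<^sub>R (B *v v)"
    by (rule linear_scale[OF matrix_vector_mul_linear])
  ultimately show ?thesis using False by (simp add: field_simps)
qed simp

context backward_orbit
begin

lemma letter_in_words: "\<gamma> \<in> set (words i j \<gamma>)"
  by (induction j) (auto simp: sub_word_def)

lemma M_ge_1: "\<beta> \<in> set (words i j \<gamma>) \<Longrightarrow> 1 \<le> M i j $ \<gamma> $ \<beta>"
  unfolding count_words[symmetric] by (metis One_nat_def Suc_leI count_list_0_iff neq0_conv of_nat_1 of_nat_mono)

lemma mat_norm_M: "mat_norm (M i j) = (\<Sum>\<alpha>\<in>UNIV. \<Sum>\<beta>\<in>UNIV. M i j $ \<alpha> $ \<beta>)"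
  by (simp add: mat_norm_def M_nonneg)

text \<open>
  Going back one step adds the column of the loser to that of the winner, and the column of the loser
  has a diagonal entry of at least \<open>1\<close>.
\<close>

lemma mat_norm_M_Suc: "mat_norm (M i (Suc j)) \<ge> mat_norm (M i j) + 1"
proof -
  have e: "M i (Suc j) $ \<alpha> $ \<beta> = M i j $ \<alpha> $ \<beta> + (if \<beta> = win (i + j) then M i j $ \<alpha> $ los (i + j) else 0)" for \<alpha> \<beta>
  proof -
    have "M i (Suc j) $ \<alpha> $ \<beta> = (\<Sum>a\<in>UNIV. (if a = \<beta> then M i j $ \<alpha> $ a else 0)
        + (if a = los (i + j) then if \<beta> = win (i + j) then M i j $ \<alpha> $ a else 0 else 0))"
      unfolding M_Suc matrix_matrix_mult_def vec_lambda_beta A_entry by (intro sum.cong) auto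
    then show ?thesis by (simp only: sum.distrib sum.delta finite UNIV_I if_True)
  qed
  have "1 \<le> M i j $ los (i + j) $ los (i + j)" by (rule M_ge_1[OF letter_in_words])
  also have "\<dots> \<le> (\<Sum>\<alpha>\<in>UNIV. M i j $ \<alpha> $ los (i + j))"
    by (rule member_le_sum) (auto simp: M_nonneg)
  finally show ?thesis
    unfolding mat_norm_M e by (simp add: sum.distrib)
qed

lemma mat_norm_M_mono: "mat_norm (M i j) \<le> mat_norm (M i (j + j'))"
proof (induction j')
  case (Suc j')
  then show ?case using mat_norm_M_Suc[of i "j + j'"] by simp
qed simp

lemma mat_norm_M_ge: "mat_norm (M i j) \<ge> 1 + real j"
proof (induction j)
  case 0
  obtain \<alpha> :: 'a where True by blast
  have "1 \<le> M i 0 $ \<alpha> $ \<alpha>" by (rule M_ge_1[OF letter_in_words])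
  also have "\<dots> \<le> (\<Sum>\<beta>\<in>UNIV. M i 0 $ \<alpha> $ \<beta>)" by (rule member_le_sum) (auto simp: M_nonneg simp del: B_back.simps)
  also have "\<dots> \<le> mat_norm (M i 0)"
    unfolding mat_norm_M by (rule member_le_sum[of \<alpha> UNIV "\<lambda>\<alpha>. \<Sum>\<beta>\<in>UNIV. M i 0 $ \<alpha> $ \<beta>"]) (auto intro!: sum_nonneg simp: M_nonneg simp del: B_back.simps)
  finally show ?case by simp
next
  case (Suc j)
  then show ?case using mat_norm_M_Suc[of i j] by simp
qed

text \<open>
  A vector in the kernel is determined by its left endpoints, each entry being the difference of two of
  them: a letter that is last in one row is not last in the other. The left endpoints are invariant, so
  they can be read off from \<open>transpose (M 0 k) *v v\<close>.
\<close>

lemma kernel_bound: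
  assumes "Omega (R 0) *v v = 0"
  shows "norm v \<le> 2 * real CARD('a) ^ 2 * norm (transpose (M 0 k) *v v)"
proof -
  let ?d = "real CARD('a)" and ?v' = "transpose (M 0 k) *v v"
  define x where "x = iet_left (fst (R 0)) v"
  have eq: "iet_left (snd (R 0)) v \<alpha> = x \<alpha>" for \<alpha>
    using arg_cong[OF assms, of "\<lambda>u. u $ \<alpha>"] Omega_mult[OF row_fst row_snd, of 0 v \<alpha>] by (simp add: x_def)
  have "\<bar>x \<alpha>\<bar> \<le> ?d * norm ?v'" for \<alpha>
  proof -
    have "x \<alpha> = iet_left (fst (R (0 + k))) ?v' \<alpha>"
      using kernel_M[of 0 v x k \<alpha>] eq by (simp add: x_def)
    then have "\<bar>x \<alpha>\<bar> \<le> (\<Sum>\<beta>\<in>UNIV. \<bar>?v' $ \<beta>\<bar>)" using left_bound by metis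
    also have "\<dots> \<le> (\<Sum>\<beta>\<in>(UNIV :: 'a set). norm ?v')" by (intro sum_mono component_le_norm_cart)
    finally show ?thesis by simp
  qed
  note x = this
  have "\<bar>v $ \<alpha>\<bar> \<le> 2 * ?d * norm ?v'" for \<alpha>
  proof -
    have "\<exists>\<beta>. v $ \<alpha> = x \<beta> - x \<alpha>"
    proof (cases "fst (R 0) \<alpha> = CARD('a)")
      case False
      then obtain \<beta> where "fst (R 0) \<beta> = fst (R 0) \<alpha> + 1"
        using row_surj[OF row_fst, of "fst (R 0) \<alpha> + 1" 0] row_range(2)[OF row_fst, of 0 \<alpha>] by auto
      from left_succ[OF row_fst this, of v] show ?thesis by (intro exI[of _ \<beta>]) (simp add: x_def)
    next
      case True
      then have "snd (R 0) \<alpha> \<noteq> CARD('a)"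
        using irreducible_last[OF two_letters, of "fst (R 0)" "snd (R 0)"] irr_R[of 0] by simp
      then obtain \<beta> where "snd (R 0) \<beta> = snd (R 0) \<alpha> + 1"
        using row_surj[OF row_snd, of "snd (R 0) \<alpha> + 1" 0] row_range(2)[OF row_snd, of 0 \<alpha>] by auto
      from left_succ[OF row_snd this, of v] show ?thesis unfolding eq by (intro exI[of _ \<beta>]) simp
    qed
    then obtain \<beta> where "v $ \<alpha> = x \<beta> - x \<alpha>" by blast
    then show ?thesis using x[of \<alpha>] x[of \<beta>] by linarith
  qed
  then have "(\<Sum>\<alpha>\<in>UNIV. \<bar>v $ \<alpha>\<bar>) \<le> (\<Sum>\<alpha>\<in>(UNIV :: 'a set). 2 * ?d * norm ?v')" by (rule sum_mono)
  then show ?thesis using norm_le_l1_cart[of v] by (simp add: power2_eq_square algebra_simps)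
qed

lemma mat_norm_Omega: "mat_norm (Omega (R k)) \<le> real CARD('a) ^ 2"
proof -
  have "mat_norm (Omega (R k)) \<le> (\<Sum>\<alpha>\<in>(UNIV :: 'a set). \<Sum>\<beta>\<in>(UNIV :: 'a set). 1)"
    unfolding mat_norm_def by (intro sum_mono) (simp add: Omega_def)
  then show ?thesis by (simp add: power2_eq_square)
qed

text \<open>
  Split \<open>v\<close> with the help of a linear \<open>g\<close> that inverts \<open>Omega\<close> on its range. The part
  \<open>g (\<Omega> v)\<close> is small since \<open>\<Omega> v = M \<Omega>' (M\<^sup>T v)\<close>, which costs one factor of the norm; the remainder
  lies in the kernel, and estimating its image costs a second factor. For a bound through cofactors
  the exponent would grow with the number of letters.
\<close>

lemma transpose_lower_bound:
  obtains C where "C > 0" "\<And>k v. norm v \<le> C * mat_norm (M 0 k) ^ 2 * norm (transpose (M 0 k) *v v)"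
proof -
  let ?d = "real CARD('a)" and ?\<Omega> = "\<lambda>v. Omega (R 0) *v v"
  obtain g where g: "linear g" "\<And>v. ?\<Omega> (g (?\<Omega> v)) = ?\<Omega> v"
    using linear_exists_right_inverse_on[OF matrix_vector_mul_linear subspace_UNIV, of "Omega (R 0)"] by blast
  obtain G where G: "G > 0" "\<And>y. norm (g y) \<le> G * norm y"
    using linear_bounded_pos[OF g(1)] by blast
  define C where "C = G * ?d ^ 2 + 2 * ?d ^ 2 * (1 + G * ?d ^ 2)"
  show ?thesis
  proof
    have "?d > 0" by simp
    then show "C > 0" unfolding C_def using G(1) by (intro add_pos_pos mult_pos_pos) auto
    fix k v
    let ?N = "mat_norm (M 0 k)" and ?c = "transpose (M 0 k) *v v"
    define v1 where "v1 = g (?\<Omega> v)"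
    have N: "1 \<le> ?N" using mat_norm_M_ge[of k 0] by linarith
    have "?N * 1 \<le> ?N * ?N" "1 * 1 \<le> ?N * ?N" using N by (intro mult_mono; simp)+
    then have N2: "?N \<le> ?N ^ 2" "1 \<le> ?N ^ 2" by (simp_all add: power2_eq_square)
    have "norm (?\<Omega> v) \<le> ?N * norm (Omega (R (0 + k)) *v ?c)"
      unfolding Omega_M[of 0 v k] by (rule norm_matrix_mult_le)
    also have "\<dots> \<le> ?N * (?d ^ 2 * norm ?c)"
      using N by (intro mult_left_mono order_trans[OF norm_matrix_mult_le] mult_right_mono mat_norm_Omega) auto
    finally have "norm v1 \<le> G * (?N * (?d ^ 2 * norm ?c))"
      unfolding v1_def using G by (meson less_imp_le mult_left_mono order_trans)
    then have v1: "norm v1 \<le> G * ?d ^ 2 * (?N * norm ?c)" by (simp add: algebra_simps)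
    have "?\<Omega> (v - v1) = 0" unfolding v1_def using g(2)[of v] by (simp add: matrix_vector_mult_diff_distrib)
    from kernel_bound[OF this, of k]
    have "norm (v - v1) \<le> 2 * ?d ^ 2 * norm (?c - transpose (M 0 k) *v v1)"
      by (simp add: matrix_vector_mult_diff_distrib)
    also have "\<dots> \<le> 2 * ?d ^ 2 * (norm ?c + ?N * (G * ?d ^ 2 * (?N * norm ?c)))"
    proof (rule mult_left_mono)
      have "norm (transpose (M 0 k) *v v1) \<le> ?N * norm v1"
        using norm_matrix_mult_le[of "transpose (M 0 k)" v1] by (simp add: mat_norm_transpose)
      also have "\<dots> \<le> ?N * (G * ?d ^ 2 * (?N * norm ?c))" using v1 N by (intro mult_left_mono) auto
      finally show "norm (?c - transpose (M 0 k) *v v1) \<le> norm ?c + ?N * (G * ?d ^ 2 * (?N * norm ?c))"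
        using norm_triangle_ineq4[of ?c "transpose (M 0 k) *v v1"] by linarith
    qed simp
    also have "\<dots> = 2 * ?d ^ 2 * (1 * norm ?c + G * ?d ^ 2 * (?N ^ 2 * norm ?c))"
      by (simp add: power2_eq_square algebra_simps)
    also have "\<dots> \<le> 2 * ?d ^ 2 * (?N ^ 2 * norm ?c + G * ?d ^ 2 * (?N ^ 2 * norm ?c))"
      using N2 by (intro mult_left_mono add_right_mono mult_right_mono) auto
    finally have v2: "norm (v - v1) \<le> 2 * ?d ^ 2 * (1 + G * ?d ^ 2) * (?N ^ 2 * norm ?c)"
      by (simp add: algebra_simps)
    have "norm v \<le> norm (v - v1) + norm v1" using norm_triangle_ineq[of "v - v1" v1] by simp
    also have "norm v1 \<le> G * ?d ^ 2 * (?N ^ 2 * norm ?c)"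
      by (rule order_trans[OF v1]) (use N2 G(1) in \<open>intro mult_left_mono mult_right_mono; simp\<close>)
    finally show "norm v \<le> C * ?N ^ 2 * norm ?c"
      using v2 by (simp add: C_def algebra_simps)
  qed
qed

text \<open>
  Condition (b) in the form of an estimate for vectors.
\<close>

definition spectral_gap :: "real \<Rightarrow> real \<Rightarrow> bool" where
  "spectral_gap \<theta> C \<longleftrightarrow> (\<forall>k v. (\<Sum>\<alpha>\<in>UNIV. q 0 $ \<alpha> * v $ \<alpha>) = 0 \<longrightarrow>
     norm (transpose (M 0 k) *v v) \<le> C * mat_norm (M 0 k) powr (1 - \<theta>) * norm v)"

lemma dual_Roth_b_gap:
  assumes "dual_Roth_b p \<tau> \<theta>"
  obtains C where "C > 0" "spectral_gap \<theta> C"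
proof -
  let ?H = "{v. (\<Sum>\<alpha>\<in>UNIV. q_at p \<tau> 0 $ \<alpha> * v $ \<alpha>) = 0}"
  obtain C where C: "C > 0" "\<And>n. n \<le> 0 \<Longrightarrow> restricted_norm (transpose (Bmat p \<tau> n 0)) ?H
      \<le> C * mat_norm (transpose (Bmat p \<tau> n 0)) powr (1 - \<theta>)"
    using assms unfolding dual_Roth_b_def by blast
  have "norm (transpose (M 0 k) *v v) \<le> C * mat_norm (M 0 k) powr (1 - \<theta>) * norm v" if "v \<in> ?H" for k v
  proof -
    have "r *\<^sub>R u \<in> ?H" if "u \<in> ?H" for r u
      using that by (simp add: sum_distrib_left[symmetric] mult.left_commute)
    then have "norm (transpose (M 0 k) *v v) \<le> restricted_norm (transpose (M 0 k)) ?H * norm v"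
      using that by (rule restricted_norm_le)
    also have "\<dots> \<le> C * mat_norm (M 0 k) powr (1 - \<theta>) * norm v"
      using C(2)[of "- int k"] by (intro mult_right_mono) (simp_all add: Bmat_def mat_norm_transpose)
    finally show ?thesis .
  qed
  then show ?thesis using that[OF C(1)] by (simp add: spectral_gap_def)
qed

text \<open>
  A vector orthogonal to \<open>q 0\<close> can be contracted at most by the square of the norm of the matrix, while
  the gap would contract it by the power \<open>\<theta> - 1\<close> of this norm, and the norms are unbounded.
\<close>

lemma gap_exponent_le:
  assumes "spectral_gap \<theta> C1" "C1 > 0"
  shows "\<theta> \<le> 3"
proof (rule ccontr)
  assume \<theta>: "\<not> \<theta> \<le> 3"
  obtain C where C: "C > 0" "\<And>k v. norm v \<le> C * mat_norm (M 0 k) ^ 2 * norm (transpose (M 0 k) *v v)"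
    using transpose_lower_bound by blast
  have "\<not> card (UNIV :: 'a set) \<le> Suc 0" using two_letters by simp
  then obtain a b :: 'a where ab: "a \<noteq> b" using card_le_Suc0_iff_eq[of "UNIV :: 'a set"] by auto
  \<comment> \<open>The hyperplane is not zero, as there are two letters.\<close>
  define v :: "real^'a" where "v = (\<chi> \<gamma>. if \<gamma> = a then q 0 $ b else if \<gamma> = b then - q 0 $ a else 0)"
  have "v $ a \<noteq> 0" using q_pos[of 0 b] by (simp add: v_def)
  then have v0: "norm v > 0" by auto
  have "(\<Sum>\<alpha>\<in>UNIV. q 0 $ \<alpha> * v $ \<alpha>) = (\<Sum>\<alpha>\<in>{a, b}. q 0 $ \<alpha> * v $ \<alpha>)"
    by (rule sum.mono_neutral_right) (auto simp: v_def)
  also have "\<dots> = 0" using ab by (simp add: v_def)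
  finally have vH: "(\<Sum>\<alpha>\<in>UNIV. q 0 $ \<alpha> * v $ \<alpha>) = 0" .
  have bound: "real k \<le> (C * C1) powr (1 / (\<theta> - 3))" for k
  proof -
    let ?N = "mat_norm (M 0 k)"
    have N: "?N \<ge> 1 + real k" by (rule mat_norm_M_ge)
    have "norm v \<le> C * ?N ^ 2 * norm (transpose (M 0 k) *v v)" by (rule C)
    also have "\<dots> \<le> C * ?N ^ 2 * (C1 * ?N powr (1 - \<theta>) * norm v)"
      using assms(1) vH C(1) by (intro mult_left_mono) (auto simp: spectral_gap_def)
    finally have "1 \<le> C * ?N ^ 2 * (C1 * ?N powr (1 - \<theta>))" using v0 by simp
    also have "\<dots> = C * C1 * (?N powr 2 * ?N powr (1 - \<theta>))" using N by (simp add: powr_numeral)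
    also have "\<dots> = C * C1 * ?N powr (- (\<theta> - 3))" by (simp flip: powr_add)
    finally have "?N powr (\<theta> - 3) * 1 \<le> ?N powr (\<theta> - 3) * (C * C1 * ?N powr (- (\<theta> - 3)))"
      by (intro mult_left_mono) auto
    also have "\<dots> = C * C1 * (?N powr (\<theta> - 3) * ?N powr (- (\<theta> - 3)))" by (simp only: mult_ac)
    also have "\<dots> = C * C1" unfolding powr_add[symmetric] using N by simp
    finally have "?N powr (\<theta> - 3) \<le> C * C1" by simp
    then have "(?N powr (\<theta> - 3)) powr (1 / (\<theta> - 3)) \<le> (C * C1) powr (1 / (\<theta> - 3))"
      using \<theta> by (intro powr_mono2) auto
    then show ?thesis using \<theta> N by (simp add: powr_powr)
  qed
  obtain k :: nat where "(C * C1) powr (1 / (\<theta> - 3)) < real k" using reals_Archimedean2 by blast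
  then show False using bound[of k] by simp
qed

text \<open>
  The gap concerns products up to time \<open>0\<close>. A vector at an intermediate time is
  pulled back to time \<open>0\<close>, where it is orthogonal to \<open>q 0\<close> because \<open>q 0 = M 0 i *v q i\<close>.
\<close>

lemma gap_intermediate:
  assumes gap: "spectral_gap \<theta> C1" and C1: "C1 > 0"
    and low: "\<And>k v. norm v \<le> C * mat_norm (M 0 k) ^ 2 * norm (transpose (M 0 k) *v v)"
    and c: "(\<Sum>\<gamma>\<in>UNIV. q i $ \<gamma> * c $ \<gamma>) = 0"
  shows "norm (transpose (M i j) *v c) \<le> C1 * mat_norm (M 0 (i + j)) powr (1 - \<theta>) * (C * mat_norm (M 0 i) ^ 2 * norm c)"
proof -
  let ?B = "transpose (M 0 i)"
  have lin: "linear (\<lambda>v. ?B *v v)" by (rule matrix_vector_mul_linear)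
  have "inj (\<lambda>v. ?B *v v)"
  proof (subst linear_injective_0[OF lin], intro allI impI)
    fix v assume "?B *v v = 0"
    then show "v = 0" using low[of v i] by simp
  qed
  then have "surj (\<lambda>v. ?B *v v)" by (rule linear_inj_imp_surj[OF lin])
  then obtain v where v: "?B *v v = c" by (metis surjD)
  have "(\<Sum>\<alpha>\<in>UNIV. q 0 $ \<alpha> * v $ \<alpha>) = (M 0 i *v q i) \<bullet> v"
    using q_M[of 0 i] by (simp add: inner_vec_def)
  also have "\<dots> = c \<bullet> q i"
    unfolding v[symmetric] transpose_matrix_vector dot_lmul_matrix by (rule inner_commute)
  also have "\<dots> = 0" using c by (simp add: inner_vec_def mult.commute)
  finally have "norm (transpose (M 0 (i + j)) *v v) \<le> C1 * mat_norm (M 0 (i + j)) powr (1 - \<theta>) * norm v"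
    using gap by (simp add: spectral_gap_def)
  moreover have "transpose (M 0 (i + j)) *v v = transpose (M i j) *v c"
    using M_add[of 0 i j] v by (simp add: matrix_transpose_mul flip: matrix_vector_mul_assoc)
  moreover have "norm v \<le> C * mat_norm (M 0 i) ^ 2 * norm c" using low[of v i] v by simp
  ultimately show ?thesis
    using C1 by (smt (verit) mult_left_mono mult_nonneg_nonneg powr_ge_zero)
qed

end


section \<open>Complete paths and balanced heights\<close>

lemma Greatest_int:
  fixes P :: "int \<Rightarrow> bool"
  assumes "P x" "\<And>y. P y \<Longrightarrow> y < b"
  shows "P (GREATEST y. P y)"
proof -
  let ?S = "{y. P y \<and> x \<le> y}"
  have S: "finite ?S" "x \<in> ?S"
    using assms by (auto intro: finite_subset[of _ "{x..<b}"])
  then have m: "Max ?S \<in> ?S" by (intro Max_in) auto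
  have "(GREATEST y. P y) = Max ?S"
  proof (rule Greatest_equality)
    fix y assume "P y"
    show "y \<le> Max ?S"
    proof (cases "x \<le> y")
      case True
      then show ?thesis using \<open>P y\<close> S by (intro Max_ge) auto
    next
      case False
      then show ?thesis using m by auto
    qed
  qed (use m in auto)
  then show ?thesis using m by auto
qed

context backward_orbit
begin

definition covers :: "nat \<Rightarrow> nat \<Rightarrow> bool" where
  "covers a b \<longleftrightarrow> (\<forall>\<alpha>. \<exists>k. a \<le> k \<and> k < b \<and> win k = \<alpha>)"

lemma complete_path_covers: "complete_path p \<tau> (- int b) (- int a) \<longleftrightarrow> covers a b"
proof
  assume "complete_path p \<tau> (- int b) (- int a)"
  then have ex: "\<exists>i. - int b < i \<and> i \<le> - int a \<and> arrow_winner p \<tau> i = \<alpha>" for \<alpha>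
    by (simp add: complete_path_def)
  show "covers a b"
    unfolding covers_def
  proof
    fix \<alpha>
    obtain i where "- int b < i" "i \<le> - int a" "arrow_winner p \<tau> i = \<alpha>" using ex by blast
    then show "\<exists>k. a \<le> k \<and> k < b \<and> win k = \<alpha>" by (intro exI[of _ "nat (- i)"]) auto
  qed
next
  assume c: "covers a b"
  show "complete_path p \<tau> (- int b) (- int a)"
    unfolding complete_path_def
  proof
    fix \<alpha>
    obtain k where "a \<le> k" "k < b" "win k = \<alpha>" using c unfolding covers_def by blast
    then show "\<exists>i. - int b < i \<and> i \<le> - int a \<and> arrow_winner p \<tau> i = \<alpha>" by (intro exI[of _ "- int k"]) auto
  qed
qed

lemma set_words_Suc:
  "set (words i (Suc j) \<alpha>) = set (words i j \<alpha>) \<union> (if los (i + j) \<in> set (words i j \<alpha>) then {win (i + j)} else {})"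
  by (auto simp: sub_word_def split: if_splits)

lemma set_words_mono: "j \<le> j' \<Longrightarrow> set (words i j \<alpha>) \<subseteq> set (words i j' \<alpha>)"
  by (induction rule: dec_induct) (use set_words_Suc in blast)+

text \<open>
  Let \<open>S\<close> be the set of letters of the word and suppose that it does not grow. Then a loser in \<open>S\<close> forces
  the winner into \<open>S\<close>. The first complete path contains a winner outside \<open>S\<close>; its loser is outside \<open>S\<close>
  too, and the next winner, being one of the two, is again outside \<open>S\<close>. So no later winner is in \<open>S\<close>,
  which contradicts the completeness of the second path.
\<close>

lemma set_words_grow:
  assumes a: "covers (i + a) (i + b)" and b: "covers (i + b) (i + c)" and neq: "set (words i a \<alpha>) \<noteq> UNIV"
  shows "set (words i a \<alpha>) \<subset> set (words i c \<alpha>)"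
proof (rule ccontr)
  assume no: "\<not> ?thesis"
  let ?S = "set (words i a \<alpha>)"
  have ab: "a < b" "b < c" using a b unfolding covers_def by (metis add_less_cancel_left le_less_trans)+
  have const: "set (words i j \<alpha>) = ?S" if "a \<le> j" "j \<le> c" for j
    using set_words_mono[OF that(1), of i \<alpha>] set_words_mono[OF that(2), of i \<alpha>] no by blast
  have avoid: "los (i + j) \<notin> ?S" if "a \<le> j" "j < c" "win (i + j) \<notin> ?S" for j
    using const[of j] const[of "Suc j"] set_words_Suc[of i j \<alpha>] that by (auto split: if_splits)
  obtain \<beta> where "\<beta> \<notin> ?S" using neq by blast
  then obtain k0 where k0: "i + a \<le> k0" "k0 < i + b" "win k0 \<notin> ?S" using a unfolding covers_def by metis
  have out: "win (k0 + r) \<notin> ?S" if "k0 + r < i + c" for r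
    using that
  proof (induction r)
    case (Suc r)
    then have "win (k0 + r) \<notin> ?S" by simp
    moreover have "los (k0 + r) \<notin> ?S"
      using avoid[of "k0 + r - i"] calculation k0 Suc.prems by (simp del: of_nat_add)
    ultimately show ?case using next_winner[of "k0 + r"] by (metis add_Suc_right)
  qed (use k0 in simp)
  obtain k1 where k1: "i + b \<le> k1" "k1 < i + c" "win k1 = \<alpha>" using b unfolding covers_def by blast
  moreover have "win k1 \<notin> ?S" using out[of "k1 - k0"] k0 k1 by (simp del: of_nat_diff)
  ultimately show False using letter_in_words by blast
qed

end

locale complete_backward_orbit = backward_orbit p \<tau> for p :: "'a::finite rows" and \<tau> +
  assumes infinitely_complete: "infinitely_complete p \<tau>"
begin

abbreviation "h k \<equiv> nat (- n_hat p \<tau> k)"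
abbreviation "N k \<equiv> mat_norm (M 0 (h k))"

lemma ex_complete: "\<exists>b > a. covers a b"
proof -
  obtain m :: "nat \<Rightarrow> int" where m: "m 0 = 0" "\<And>k. m (Suc k) < m k"
      "\<And>k. complete_path p \<tau> (m (Suc k)) (m k)"
    using infinitely_complete unfolding infinitely_complete_def by blast
  have le: "m k \<le> - int k" for k
  proof (induction k)
    case (Suc k)
    then show ?case using m(2)[of k] by simp
  qed (use m in simp)
  let ?b = "nat (- m (Suc a))" and ?a' = "nat (- m a)"
  have "complete_path p \<tau> (- int ?b) (- int ?a')" using m(3)[of a] le[of a] le[of "Suc a"] by simp
  then have "covers ?a' ?b" by (simp only: complete_path_covers)
  moreover have "a \<le> ?a'" "a < ?b" using le[of a] le[of "Suc a"] by linarith+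
  ultimately show ?thesis unfolding covers_def by (meson order_trans)
qed

lemma n_hat_step: "n_hat p \<tau> k \<le> 0 \<and> n_hat p \<tau> (Suc k) < n_hat p \<tau> k
    \<and> complete_path p \<tau> (n_hat p \<tau> (Suc k)) (n_hat p \<tau> k)"
proof (induction k)
  case 0
  obtain b where "b > 0" "covers 0 b" using ex_complete by blast
  then have P: "- int b < 0 \<and> complete_path p \<tau> (- int b) 0"
    using complete_path_covers[of b 0] by simp
  have "(GREATEST n. n < 0 \<and> complete_path p \<tau> n 0) < 0
      \<and> complete_path p \<tau> (GREATEST n. n < 0 \<and> complete_path p \<tau> n 0) 0"
    by (rule Greatest_int[of "\<lambda>n. n < 0 \<and> complete_path p \<tau> n 0"]) (use P in auto)
  then show ?case by simp
next
  case (Suc k)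
  let ?n = "n_hat p \<tau> (Suc k)"
  have n: "?n \<le> 0" using Suc by linarith
  obtain b where "b > nat (- ?n)" "covers (nat (- ?n)) b" using ex_complete by blast
  then have P: "- int b < ?n \<and> complete_path p \<tau> (- int b) ?n"
    using complete_path_covers[of b "nat (- ?n)"] n by (simp del: n_hat.simps)
  have "(GREATEST n. n < ?n \<and> complete_path p \<tau> n ?n) < ?n
      \<and> complete_path p \<tau> (GREATEST n. n < ?n \<and> complete_path p \<tau> n ?n) ?n"
    by (rule Greatest_int[of "\<lambda>n. n < ?n \<and> complete_path p \<tau> n ?n"]) (use P in blast)+
  then show ?case using n n_hat.simps(2)[of p \<tau> "Suc k"] by metis
qed

lemma int_h: "- int (h k) = n_hat p \<tau> k"
  using n_hat_step[of k] by simp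

lemma h_Suc: "h k < h (Suc k)" and covers_h: "covers (h k) (h (Suc k))"
  using n_hat_step[of k] complete_path_covers[of "h (Suc k)" "h k"] unfolding int_h by linarith+

lemma h_mono: "k \<le> k' \<Longrightarrow> h k \<le> h k'"
proof (induction rule: dec_induct)
  case (step n)
  then show ?case using h_Suc[of n] by linarith
qed simp

lemma h_ge: "k \<le> h k"
proof (induction k)
  case (Suc k)
  then show ?case using h_Suc[of k] by linarith
qed simp

lemma N_mono: "k \<le> k' \<Longrightarrow> N k \<le> N k'"
  using mat_norm_M_mono[of 0 "h k" "h k' - h k"] h_mono[of k k'] by (simp del: n_hat.simps)

lemma N_ge_1: "1 \<le> N k"
  using mat_norm_M_ge[of "h k" 0] by linarith

lemma N_Suc: "N (Suc k) \<le> N k * mat_norm (Bmat p \<tau> (n_hat p \<tau> (Suc k)) (n_hat p \<tau> k))"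
proof -
  have "Bmat p \<tau> (n_hat p \<tau> (Suc k)) (n_hat p \<tau> k) = M (h k) (h (Suc k) - h k)"
  proof -
    have e: "nat (n_hat p \<tau> k - n_hat p \<tau> (Suc k)) = h (Suc k) - h k"
      using n_hat_step[of k] n_hat_step[of "Suc k"] by linarith
    show ?thesis unfolding Bmat_def e int_h ..
  qed
  moreover have "M 0 (h (Suc k)) = M 0 (h k) ** M (h k) (h (Suc k) - h k)"
    using M_add[of 0 "h k" "h (Suc k) - h k"] h_Suc[of k] by (simp del: n_hat.simps)
  ultimately show ?thesis using mat_norm_mult by metis
qed

text \<open>
  Every two complete paths add a letter to the word, so the matrix of \<open>2 d\<close> complete paths is positive.
\<close>

lemma covering_words: "set (words (h k) (h (k + 2 * CARD('a)) - h k) \<alpha>) = UNIV"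
proof -
  let ?S = "\<lambda>r. set (words (h k) (h (k + 2 * r) - h k) \<alpha>)"
  have grow: "r < card (?S r) \<or> ?S r = UNIV" for r
  proof (induction r)
    case 0
    have "\<alpha> \<in> ?S 0" by (rule letter_in_words)
    then have "0 < card (?S 0)" by (metis List.finite_set card_gt_0_iff empty_iff)
    then show ?case by blast
  next
    case (Suc r)
    have le: "h k \<le> h (k + 2 * r)" "h k \<le> h (k + 2 * r + 1)" "h k \<le> h (k + 2 * Suc r)" by (intro h_mono; simp)+
    show ?case
    proof (cases "?S r = UNIV")
      case True
      have "h (k + 2 * r) - h k \<le> h (k + 2 * Suc r) - h k" by (intro diff_le_mono h_mono) simp
      from set_words_mono[OF this, of "h k" \<alpha>] show ?thesis using True by blast
    next
      case False
      have "?S r \<subset> ?S (Suc r)"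
      proof (rule set_words_grow[OF _ _ False])
        show "covers (h k + (h (k + 2 * r) - h k)) (h k + (h (k + 2 * r + 1) - h k))"
          using covers_h[of "k + 2 * r"] le by (simp del: n_hat.simps)
        show "covers (h k + (h (k + 2 * r + 1) - h k)) (h k + (h (k + 2 * Suc r) - h k))"
          using covers_h[of "k + 2 * r + 1"] le by (simp del: n_hat.simps)
      qed
      then have "card (?S r) < card (?S (Suc r))" by (intro psubset_card_mono) auto
      then show ?thesis using Suc False by linarith
    qed
  qed
  have "card (?S CARD('a)) \<le> CARD('a)" by (rule card_mono) auto
  then show ?thesis using grow[of "CARD('a)"] by simp
qed

lemma q_le_sum: "q i $ \<gamma> \<le> (\<Sum>\<alpha>\<in>UNIV. q 0 $ \<alpha>)"
proof -
  have "q i $ \<gamma> \<le> M 0 i $ \<gamma> $ \<gamma> * q i $ \<gamma>"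
    using M_ge_1[OF letter_in_words, of 0 i \<gamma>] q_pos[of i \<gamma>] by (simp add: mult_le_cancel_right1)
  also have "\<dots> \<le> (\<Sum>\<beta>\<in>UNIV. M 0 i $ \<gamma> $ \<beta> * q i $ \<beta>)"
    by (rule member_le_sum; (rule UNIV_I | rule finite | rule mult_nonneg_nonneg[OF M_nonneg less_imp_le[OF q_pos]]))
  also have "\<dots> = q 0 $ \<gamma>" using q_M[of 0 i] by (simp add: matrix_vector_mult_def)
  also have "\<dots> \<le> (\<Sum>\<alpha>\<in>UNIV. q 0 $ \<alpha>)"
    by (rule member_le_sum) (auto simp: less_imp_le[OF q_pos[of 0, simplified]])
  finally show ?thesis .
qed

text \<open>
  By positivity every height at time \<open>n_hat k\<close> dominates all heights \<open>2 d\<close> complete paths earlier, and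
  \<open>q 0 = M 0 (h k) *v q (h k)\<close>.
\<close>

lemma q_balanced: "N k * q (h (k + 2 * CARD('a))) $ \<beta> \<le> (\<Sum>\<alpha>\<in>UNIV. q 0 $ \<alpha>)"
proof -
  let ?i = "h k" and ?j = "h (k + 2 * CARD('a)) - h k"
  have ij: "?i + ?j = h (k + 2 * CARD('a))" using h_mono[of k "k + 2 * CARD('a)"] by simp
  have "q (?i + ?j) $ \<beta> \<le> q ?i $ \<gamma>" for \<gamma>
  proof -
    have "q (?i + ?j) $ \<beta> \<le> M ?i ?j $ \<gamma> $ \<beta> * q (?i + ?j) $ \<beta>"
      using M_ge_1[of \<beta> ?i ?j \<gamma>] covering_words[of k \<gamma>] q_pos[of "?i + ?j" \<beta>]
      by (simp only: mult_le_cancel_right1 UNIV_I simp_thms) auto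
    also have "\<dots> \<le> (\<Sum>\<beta>\<in>UNIV. M ?i ?j $ \<gamma> $ \<beta> * q (?i + ?j) $ \<beta>)"
      by (rule member_le_sum; (rule UNIV_I | rule finite | rule mult_nonneg_nonneg[OF M_nonneg less_imp_le[OF q_pos]]))
    also have "\<dots> = q ?i $ \<gamma>" unfolding q_M[of ?i ?j] by (simp only: matrix_vector_mult_def vec_lambda_beta)
    finally show ?thesis .
  qed
  then have "(\<Sum>\<alpha>\<in>UNIV. \<Sum>\<gamma>\<in>UNIV. M 0 ?i $ \<alpha> $ \<gamma> * q (?i + ?j) $ \<beta>)
      \<le> (\<Sum>\<alpha>\<in>UNIV. \<Sum>\<gamma>\<in>UNIV. M 0 ?i $ \<alpha> $ \<gamma> * q ?i $ \<gamma>)"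
    by (intro sum_mono mult_left_mono M_nonneg)
  also have "\<dots> = (\<Sum>\<alpha>\<in>UNIV. q 0 $ \<alpha>)"
    using q_M[of 0 ?i] by (simp add: matrix_vector_mult_def del: n_hat.simps)
  finally show ?thesis unfolding mat_norm_M ij by (simp add: sum_distrib_right)
qed

text \<open>
  Condition (a) gives \<open>N (k + 1) \<le> C * N k powr (1 + \<epsilon>)\<close> with arbitrarily small \<open>\<epsilon>\<close>; the number \<open>r\<close> of
  iterations is fixed, so that any exponent larger than \<open>1\<close> can be reached.
\<close>

lemma N_power_growth:
  assumes "dual_Roth_a p \<tau>"
  obtains C where "C > 0" "\<And>k. N (k + r) \<le> C * N k powr 2"
proof -
  \<comment> \<open>This choice makes \<open>(1 + \<epsilon>) ^ (r + 1) = 2\<close>.\<close>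
  define \<epsilon> :: real where "\<epsilon> = 2 powr (1 / (real r + 1)) - 1"
  have \<epsilon>: "\<epsilon> > 0" by (simp add: \<epsilon>_def)
  obtain C0 where C0: "C0 > 0" "\<And>k. mat_norm (Bmat p \<tau> (n_hat p \<tau> (Suc k)) (n_hat p \<tau> k))
      \<le> C0 * mat_norm (Bmat p \<tau> (n_hat p \<tau> k) 0) powr \<epsilon>"
    using assms \<epsilon> unfolding dual_Roth_a_def by blast
  have step: "N (Suc k) \<le> C0 * N k powr (1 + \<epsilon>)" for k
  proof -
    have "Bmat p \<tau> (n_hat p \<tau> k) 0 = M 0 (h k)" by (simp add: Bmat_def)
    then have c: "mat_norm (Bmat p \<tau> (n_hat p \<tau> (Suc k)) (n_hat p \<tau> k)) \<le> C0 * N k powr \<epsilon>"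
      using C0(2)[of k] by metis
    have "N (Suc k) \<le> N k * (C0 * N k powr \<epsilon>)"
      by (rule order_trans[OF N_Suc mult_left_mono[OF c mat_norm_nonneg]])
    then show ?thesis using N_ge_1[of k] by (simp add: powr_add mult_ac)
  qed
  have "\<exists>C>0. \<forall>k. N (k + s) \<le> C * N k powr ((1 + \<epsilon>) ^ s)" for s
  proof (induction s)
    case 0
    have "N (k + 0) \<le> 1 * N k powr ((1 + \<epsilon>) ^ 0)" for k using N_ge_1[of k] by simp
    then show ?case by (intro exI[of _ 1]) simp
  next
    case (Suc s)
    then obtain C where C: "C > 0" "\<And>k. N (k + s) \<le> C * N k powr ((1 + \<epsilon>) ^ s)" by blast
    have "N (k + Suc s) \<le> (C0 * C powr (1 + \<epsilon>)) * N k powr ((1 + \<epsilon>) ^ Suc s)" for k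
    proof -
      have "N (k + Suc s) \<le> C0 * N (k + s) powr (1 + \<epsilon>)" using step[of "k + s"] by simp
      also have "\<dots> \<le> C0 * (C * N k powr ((1 + \<epsilon>) ^ s)) powr (1 + \<epsilon>)"
        using C0(1) C(2)[of k] N_ge_1[of "k + s"] \<epsilon> by (intro mult_left_mono powr_mono2) linarith+
      also have "\<dots> = (C0 * C powr (1 + \<epsilon>)) * N k powr ((1 + \<epsilon>) ^ Suc s)"
        using C(1) by (simp add: powr_mult powr_powr mult_ac)
      finally show ?thesis .
    qed
    then show ?case using C0(1) C(1) by (intro exI[of _ "C0 * C powr (1 + \<epsilon>)"]) auto
  qed
  then obtain C where C: "C > 0" "\<And>k. N (k + r) \<le> C * N k powr ((1 + \<epsilon>) ^ r)" by blast
  have "(1 + \<epsilon>) ^ r \<le> (1 + \<epsilon>) ^ Suc r" using \<epsilon> by (intro power_increasing) auto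
  also have "\<dots> = (1 + \<epsilon>) powr (real r + 1)" using \<epsilon> by (subst powr_realpow[symmetric]) (auto simp: add.commute)
  also have "\<dots> = 2" by (simp add: \<epsilon>_def powr_powr)
  finally have "N k powr ((1 + \<epsilon>) ^ r) \<le> N k powr 2" for k using N_ge_1[of k] by (intro powr_mono)
  then have "N (k + r) \<le> C * N k powr 2" for k
    using C by (meson less_imp_le mult_left_mono order_trans)
  then show ?thesis using that C(1) by blast
qed

end


section \<open>The estimate of the dual sums\<close>

context complete_backward_orbit
begin

text \<open>
  Take the largest \<open>K\<close> such that \<open>h K \<le> n\<close> and \<open>N K\<close> is at most of order \<open>mat_norm (M 0 n) powr s\<close>. Since
  \<open>N (K + 1)\<close> exceeds this value, or even \<open>mat_norm (M 0 n)\<close> when \<open>h (K + 1) > n\<close>, the power growth shows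
  that \<open>N (K - 2 d)\<close> is at least of the order of its square root. The balance of heights turns this
  into the bound for \<open>q\<close>.
\<close>

lemma intermediate_time:
  assumes a: "dual_Roth_a p \<tau>" and s: "0 \<le> s" "s \<le> 1"
  obtains C where "C > 0" "\<And>n. \<exists>i\<le>n. mat_norm (M 0 i) \<le> C * mat_norm (M 0 n) powr s
      \<and> (\<forall>\<gamma>. q i $ \<gamma> \<le> C * mat_norm (M 0 n) powr (- (s / 2)))"
proof -
  let ?d = "CARD('a)"
  define D where "D = N 0"
  define Q where "Q = (\<Sum>\<alpha>\<in>UNIV. q 0 $ \<alpha>)"
  obtain C2 where C2: "C2 > 0" "\<And>k. N (k + (2 * ?d + 1)) \<le> C2 * N k powr 2"
    using N_power_growth[OF a] by blast
  have D: "1 \<le> D" unfolding D_def by (rule N_ge_1)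
  obtain \<alpha> :: 'a where True by blast
  have Q: "0 < Q" using q_pos[of 0 \<alpha>] q_le_sum[of 0 \<alpha>] by (simp add: Q_def)
  define C where "C = D + D * Q * C2 powr (1 / 2)"
  have C: "C > 0" "C \<ge> D" "C \<ge> D * Q * C2 powr (1 / 2)" unfolding C_def using D Q C2(1) by (auto intro!: add_pos_nonneg)
  have "\<exists>i\<le>n. mat_norm (M 0 i) \<le> C * mat_norm (M 0 n) powr s
      \<and> (\<forall>\<gamma>. q i $ \<gamma> \<le> C * mat_norm (M 0 n) powr (- (s / 2)))" for n
  proof -
    let ?N = "mat_norm (M 0 n)"
    have N: "1 \<le> ?N" using mat_norm_M_ge[of n 0] by linarith
    have Ns: "1 \<le> ?N powr s" "?N powr s \<le> ?N"
      using N s powr_mono[of s 1 ?N] by (auto intro: ge_one_powr_ge_zero)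
    \<comment> \<open>The factor \<open>D = N 0\<close> ensures that \<open>0\<close> belongs to the set.\<close>
    let ?S = "{k. h k \<le> n \<and> N k \<le> D * ?N powr s}"
    have "?S \<subseteq> {..n}" using h_ge order_trans by blast
    then have fin: "finite ?S" by (rule finite_subset) simp
    have "D * 1 \<le> D * ?N powr s" using D Ns by (intro mult_left_mono) auto
    then have "0 \<in> ?S" by (simp add: D_def)
    define K where "K = Max ?S"
    have K: "h K \<le> n" "N K \<le> D * ?N powr s" using Max_in[OF fin] \<open>0 \<in> ?S\<close> unfolding K_def by blast+
    have "Suc K \<notin> ?S" using Max_ge[OF fin, of "Suc K"] unfolding K_def by auto
    have next_large: "?N powr s \<le> N (Suc K)"
    proof (cases "h (Suc K) \<le> n")
      case True
      then have "D * ?N powr s \<le> N (Suc K)" using \<open>Suc K \<notin> ?S\<close> by (simp del: n_hat.simps)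
      moreover have "1 * ?N powr s \<le> D * ?N powr s" using D by (intro mult_right_mono) auto
      ultimately show ?thesis by linarith
    next
      case False
      then have "?N \<le> N (Suc K)"
        using mat_norm_M_mono[of 0 n "h (Suc K) - n"] by (simp del: n_hat.simps)
      then show ?thesis using Ns by linarith
    qed
    \<comment> \<open>For \<open>K < 2 * ?d\<close> this is \<open>0\<close>; the norm \<open>N 0\<close> is then absorbed in the constant.\<close>
    let ?k = "K - 2 * ?d"
    have "N (Suc K) \<le> N (?k + (2 * ?d + 1))" by (rule N_mono) simp
    then have "?N powr s \<le> C2 * N ?k powr 2" using next_large C2(2)[of ?k] by linarith
    then have "?N powr s / C2 \<le> N ?k powr 2" using C2(1) by (simp add: field_simps)
    then have "(?N powr s / C2) powr (1 / 2) \<le> (N ?k powr 2) powr (1 / 2)"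
      using C2(1) by (intro powr_mono2) auto
    also have "\<dots> = N ?k" using N_ge_1[of ?k] by (simp add: powr_powr del: n_hat.simps)
    finally have root: "?N powr (s / 2) / C2 powr (1 / 2) \<le> N ?k"
      using C2(1) by (simp add: powr_divide powr_powr)
    have "N ?k * q (h K) $ \<gamma> \<le> D * Q" for \<gamma>
    proof (cases "2 * ?d \<le> K")
      case True
      have "N ?k * q (h K) $ \<gamma> \<le> Q" using q_balanced[of ?k \<gamma>] True by (simp add: Q_def)
      also have "\<dots> \<le> D * Q" using D Q by simp
      finally show ?thesis .
    next
      case False
      then show ?thesis
        using q_le_sum[of "h K" \<gamma>] D by (auto simp: D_def Q_def intro: mult_left_mono)
    qed
    then have "(?N powr (s / 2) / C2 powr (1 / 2)) * q (h K) $ \<gamma> \<le> D * Q" for \<gamma>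
      using mult_right_mono[OF root less_imp_le[OF q_pos[of "h K" \<gamma>]]] order_trans by blast
    then have "q (h K) $ \<gamma> \<le> D * Q * C2 powr (1 / 2) * ?N powr (- (s / 2))" for \<gamma>
      using N C2(1) by (simp add: powr_minus field_simps)
    then have "q (h K) $ \<gamma> \<le> C * ?N powr (- (s / 2))" for \<gamma>
      using mult_right_mono[OF C(3), of "?N powr (- (s / 2))"] order_trans by fastforce
    moreover have "N K \<le> C * ?N powr s"
      by (rule order_trans[OF K(2) mult_right_mono[OF C(2)]]) simp
    ultimately show ?thesis using K(1) by blast
  qed
  then show ?thesis using that C(1) by blast
qed

end

locale complete_backward_orbit_lengths =
  backward_orbit_lengths p \<tau> lam + complete_backward_orbit p \<tau> for p :: "'a::finite rows" and \<tau> lam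
begin

text \<open>
  With the exponent \<open>\<theta> / 4\<close> for the norm at the intermediate time, the vector \<open>c\<close> costs one factor of
  this norm and its pull-back to time \<open>0\<close> two more, which leaves the exponent
  \<open>1 - \<theta> + 3 * (\<theta> / 4)\<close>.
\<close>

lemma dual_sum_bound:
  assumes a: "dual_Roth_a p \<tau>" and b: "dual_Roth_b p \<tau> \<theta>" and \<eta>: "0 < \<eta>" "\<eta> < 1"
  obtains C where "C > 0" "\<And>\<psi> n \<beta> x. holder_on (L p \<tau> 0) \<eta> \<psi> \<Longrightarrow> mean_zero (L p \<tau> 0) \<psi> \<Longrightarrow>
      x \<in> L p \<tau> (- int n) \<beta> \<Longrightarrow>
      \<bar>S_sharp p \<tau> lam 0 (- int n) \<psi> \<beta> x\<bar>
        \<le> C * holder_norm (L p \<tau> 0) \<eta> \<psi> * mat_norm (M 0 n) powr (1 - 1 / 20 * \<theta> * \<eta>)"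
proof -
  let ?d = "real CARD('a)"
  have \<theta>: "\<theta> > 0" using b by (simp add: dual_Roth_b_def)
  obtain C1 where C1: "C1 > 0" "spectral_gap \<theta> C1" using dual_Roth_b_gap[OF b] by blast
  have \<theta>3: "\<theta> \<le> 3" by (rule gap_exponent_le[OF C1(2,1)])
  obtain C2 where C2: "C2 > 0"
      "\<And>k v. norm v \<le> C2 * mat_norm (M 0 k) ^ 2 * norm (transpose (M 0 k) *v v)"
    using transpose_lower_bound by blast
  have s: "0 \<le> \<theta> / 4" "\<theta> / 4 \<le> 1" using \<theta> \<theta>3 by auto
  obtain C3 where C3: "C3 > 0" "\<And>n. \<exists>i\<le>n. mat_norm (M 0 i) \<le> C3 * mat_norm (M 0 n) powr (\<theta> / 4)
      \<and> (\<forall>\<gamma>. q i $ \<gamma> \<le> C3 * mat_norm (M 0 n) powr (- (\<theta> / 4 / 2)))"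
    using intermediate_time[OF a s] by blast
  define A1 where "A1 = C1 * C2 * ?d * C3 ^ 3"
  define A2 where "A2 = C3 powr \<eta>"
  have A: "0 \<le> A1" "0 < A2" using C1 C2 C3 by (auto simp: A1_def A2_def)
  show ?thesis
  proof
    show "A1 + A2 > 0" using A by simp
    fix \<psi> n \<beta> x
    assume \<psi>: "holder_on (L p \<tau> 0) \<eta> \<psi>" "mean_zero (L p \<tau> 0) \<psi>" and x: "x \<in> L p \<tau> (- int n) \<beta>"
    let ?N = "mat_norm (M 0 n)" and ?e = "1 - 1 / 20 * \<theta> * \<eta>"
    let ?P = "C0_norm (L p \<tau> 0) \<psi>" and ?H = "holder_seminorm (L p \<tau> 0) \<eta> \<psi>"
    have L0: "L p \<tau> 0 = (\<lambda>\<alpha>. {0<..<q 0 $ \<alpha>})" by (auto simp: L_def)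
    note bnd = holder_norm_bounds[of "\<lambda>\<alpha>. q 0 $ \<alpha>", OF q_pos \<eta>(1) \<psi>(1)[unfolded L0], folded L0]
    have N: "1 \<le> ?N" using mat_norm_M_ge[of n 0] by linarith
    obtain i where i: "i \<le> n" "mat_norm (M 0 i) \<le> C3 * ?N powr (\<theta> / 4)"
        "\<And>\<gamma>. q i $ \<gamma> \<le> C3 * ?N powr (- (\<theta> / 4 / 2))"
      using C3(2) by blast
    let ?j = "n - i" and ?Ni = "mat_norm (M 0 i)"
    have n: "n = i + ?j" using i(1) by simp
    obtain c where c: "(\<Sum>\<gamma>\<in>UNIV. q i $ \<gamma> * c $ \<gamma>) = 0" "\<And>\<gamma>. \<bar>c $ \<gamma>\<bar> \<le> ?P * ?Ni"
        "\<bar>S_sharp p \<tau> lam 0 (- int n) \<psi> \<beta> x - (transpose (M i ?j) *v c) $ \<beta>\<bar>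
           \<le> ?H * (C3 * ?N powr (- (\<theta> / 4 / 2))) powr \<eta> * ?N"
    proof (rule dual_sum_decomposition[OF \<psi> \<eta>(1) i(3), of ?j, folded n])
    qed (use that x in blast)
    have "\<theta> * \<eta> \<le> \<theta> * 1" using \<theta> \<eta> by (intro mult_left_mono) auto
    then have exponents: "1 - \<theta> / 4 \<le> ?e" "- (\<theta> / 4 / 2) * \<eta> + 1 \<le> ?e" using \<theta> \<eta> by (auto simp: field_simps)
    have "norm c \<le> (\<Sum>\<gamma>\<in>(UNIV :: 'a set). ?P * ?Ni)"
      by (rule order_trans[OF norm_le_l1_cart]) (rule sum_mono, rule c(2))
    then have normc: "norm c \<le> ?d * (?P * ?Ni)" by simp
    have Ni: "0 \<le> ?Ni" by (rule mat_norm_nonneg)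
    have "\<bar>(transpose (M i ?j) *v c) $ \<beta>\<bar> \<le> norm (transpose (M i ?j) *v c)" by (rule component_le_norm_cart)
    also have "\<dots> \<le> C1 * ?N powr (1 - \<theta>) * (C2 * ?Ni ^ 2 * norm c)"
      using gap_intermediate[OF C1(2,1) C2(2) c(1), of ?j] n by metis
    also have "\<dots> \<le> C1 * ?N powr (1 - \<theta>) * (C2 * ?Ni ^ 2 * (?d * (?P * ?Ni)))"
      using normc C1(1) C2(1) by (intro mult_left_mono) auto
    also have "\<dots> = C1 * C2 * ?d * ?P * (?N powr (1 - \<theta>) * ?Ni ^ 3)"
      by (simp add: power2_eq_square power3_eq_cube)
    also have "\<dots> \<le> C1 * C2 * ?d * ?P * (?N powr (1 - \<theta>) * (C3 * ?N powr (\<theta> / 4)) ^ 3)"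
      using C1(1) C2(1) bnd(3) Ni i(2) by (intro mult_left_mono power_mono) auto
    also have "\<dots> = A1 * ?P * (?N powr (1 - \<theta>) * ?N powr (3 * (\<theta> / 4)))"
    proof -
      have "(?N powr (\<theta> / 4)) ^ 3 = ?N powr (3 * (\<theta> / 4))"
        unfolding power3_eq_cube powr_add[symmetric] by simp
      then show ?thesis unfolding A1_def power_mult_distrib by (simp only: mult_ac)
    qed
    also have "\<dots> = A1 * ?P * ?N powr (1 - \<theta> / 4)"
      by (simp flip: powr_add)
    also have "\<dots> \<le> A1 * ?P * ?N powr ?e"
      using exponents(1) N A(1) bnd(3) by (intro mult_left_mono powr_mono) auto
    finally have main: "\<bar>(transpose (M i ?j) *v c) $ \<beta>\<bar> \<le> A1 * ?P * ?N powr ?e" .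
    have "?H * (C3 * ?N powr (- (\<theta> / 4 / 2))) powr \<eta> * ?N
        = A2 * ?H * (?N powr (- (\<theta> / 4 / 2) * \<eta>) * ?N powr 1)"
      using C3(1) N by (simp add: A2_def powr_mult powr_powr)
    also have "\<dots> = A2 * ?H * ?N powr (- (\<theta> / 4 / 2) * \<eta> + 1)"
      by (simp only: powr_add)
    also have "\<dots> \<le> A2 * ?H * ?N powr ?e"
      using exponents(2) N A(2) bnd(4) by (intro mult_left_mono powr_mono) auto
    finally have "\<bar>S_sharp p \<tau> lam 0 (- int n) \<psi> \<beta> x\<bar> \<le> A1 * ?P * ?N powr ?e + A2 * ?H * ?N powr ?e"
      using main c(3) by linarith
    also have "\<dots> \<le> (A1 + A2) * (?P + ?H) * ?N powr ?e"
      using A bnd(3,4) by (simp add: algebra_simps)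
    finally show "\<bar>S_sharp p \<tau> lam 0 (- int n) \<psi> \<beta> x\<bar> \<le> (A1 + A2) * holder_norm (L p \<tau> 0) \<eta> \<psi> * ?N powr ?e"
      by (simp add: holder_norm_def)
  qed
qed

end

theorem proposition4p10:
  fixes p :: "'a::finite rows" and \<tau> lam :: "real^'a" and \<theta> \<eta> :: real
  assumes "CARD('a) \<ge> 2"
    and "irreducible_rows p"
    and "\<tau> \<in> Theta p"
    and "\<forall>\<alpha>. lam $ \<alpha> > 0"
    and "dual_Roth_type p \<tau>"
    and "dual_Roth_b p \<tau> \<theta>"
    and "0 < \<eta>" and "\<eta> < 1"
  shows "\<exists>C. \<forall>\<psi>. holder_on (L p \<tau> 0) \<eta> \<psi> \<and> mean_zero (L p \<tau> 0) \<psi> \<longrightarrow>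
           (\<forall>n\<le>0. C0_norm (L p \<tau> n) (S_sharp p \<tau> lam 0 n \<psi>)
              \<le> C * holder_norm (L p \<tau> 0) \<eta> \<psi> * mat_norm (Bmat p \<tau> n 0) powr (1 - 1 / 20 * \<theta> * \<eta>))"
proof -
  have dual: "backward_defined p \<tau>" "infinitely_complete p \<tau>" "dual_Roth_a p \<tau>"
    using assms(5) by (auto simp: dual_Roth_type_def)
  interpret complete_backward_orbit_lengths p \<tau> lam
    using assms(1-4) dual(1,2) by unfold_locales auto
  obtain C where C: "\<And>\<psi> n \<beta> x. holder_on (L p \<tau> 0) \<eta> \<psi> \<Longrightarrow> mean_zero (L p \<tau> 0) \<psi> \<Longrightarrow>
      x \<in> L p \<tau> (- int n) \<beta> \<Longrightarrow>
      \<bar>S_sharp p \<tau> lam 0 (- int n) \<psi> \<beta> x\<bar>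
        \<le> C * holder_norm (L p \<tau> 0) \<eta> \<psi> * mat_norm (M 0 n) powr (1 - 1 / 20 * \<theta> * \<eta>)"
    using dual_sum_bound[OF dual(3) assms(6-8)] by metis
  show ?thesis
  proof (intro exI[of _ C] allI impI, elim conjE)
    fix \<psi> and n :: int
    assume \<psi>: "holder_on (L p \<tau> 0) \<eta> \<psi>" "mean_zero (L p \<tau> 0) \<psi>" and "n \<le> 0"
    then obtain k where k: "n = - int k" by (metis nonpos_int_cases)
    have "q k $ \<alpha> / 2 \<in> L p \<tau> n \<alpha>" for \<alpha> using q_pos[of k \<alpha>] by (simp add: L_def k)
    moreover have "Bmat p \<tau> n 0 = M 0 k" by (simp add: Bmat_def k)
    ultimately show "C0_norm (L p \<tau> n) (S_sharp p \<tau> lam 0 n \<psi>)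
        \<le> C * holder_norm (L p \<tau> 0) \<eta> \<psi> * mat_norm (Bmat p \<tau> n 0) powr (1 - 1 / 20 * \<theta> * \<eta>)"
      unfolding C0_norm_def using C[OF \<psi>, of _ k] by (intro cSup_least) (auto simp: k)
  qed
qed

end
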